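(* Let $f:\mathbb{B}\to\mathbb{B}$ be an inner function. Then $f$ is Lipschitz with respect to the metric $g$ (i.e. there is a constant $K$ with $d_g(f(p),f(q))\le K\,d_g(p,q)$ for all $p,q\in\mathbb{B}$) if and only if $f$ is slice preserving. In this case, $f$ is a contraction, i.e. $d_g(f(p),f(q))\le d_g(p,q)$ for all $p,q\in\mathbb{B}$.
   Context: $\mathbb{H}$ is the skew-field of quaternions, $\mathbb{B}=\{q\in\mathbb{H}:|q|<1\}$, $\mathbb{S}=\{q\in\mathbb{H}:q^2=-1\}$, $L_I=\mathbb{R}+\mathbb{R}I$ for $I\in\mathbb{S}$, and $\mathbb{B}_I=\mathbb{B}\cap L_I$. A function $f:\mathbb{B}\to\mathbb{H}$ is (slice) regular if for each $I\in\mathbb{S}$ the restriction $f_I=f|_{\mathbb{B}_I}$ has continuous partial derivatives and $\frac12(\partial_x+I\partial_y)f_I(x+yI)=0$ on $\mathbb{B}_I$; equivalently, $f(q)=\sum_{n\ge0}q^na_n$ with $a_n\in\mathbb{H}$, converging in $\mathbb{B}$. A regular function $f:\mathbb{B}\to\mathbb{H}$ is inner if (i) it maps $\mathbb{B}$ into $\mathbb{B}$; (ii) for a.e. $u\in\partial\mathbb{B}$ the limit of $f(ru)$ as $r\to1$ exists and has unit norm. A function $f:\mathbb{B}\to\mathbb{H}$ is slice preserving if $f(L_I\cap\mathbb{B})\subseteq L_I$ for all $I\in\mathbb{S}$. $g$ is the Riemannian metric on $\mathbb{B}$ given, for $w=x+yI_w\in\mathbb{B}$ and $d=d_1+d_2\in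 T_w\mathbb{B}\cong\mathbb{H}$ with $d_1\in L_{I_w}$, $d_2\in L_{I_w}^\perp$ (Euclidean orthogonal complement), by $|d|^2_{g(w)}=\frac{|d_1|^2}{(1-|w|^2)^2}+\frac{|d_2|^2}{|1-w^2|^2}$; $d_g$ is its distance function. *)

theory Defs
  imports "HOL-Analysis.Analysis"
begin

section \<open>The skew-field of quaternions\<close>

datatype quat = Quat (q1: real) (qi: real) (qj: real) (qk: real)

lemma quat_eq_iff: "p = q \<longleftrightarrow> q1 p = q1 q \<and> qi p = qi q \<and> qj p = qj q \<and> qk p = qk q"
  by (auto intro: quat.expand)

instantiation quat :: ab_group_add
begin

definition "0 = Quat 0 0 0 0"
definition "p + q = Quat (q1 p + q1 q) (qi p + qi q) (qj p + qj q) (qk p + qk q)"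
definition "- p = Quat (- q1 p) (- qi p) (- qj p) (- qk p)"
definition "p - q = Quat (q1 p - q1 q) (qi p - qi q) (qj p - qj q) (qk p - qk q)" for p q :: quat

instance
  by standard
    (simp_all add: zero_quat_def plus_quat_def uminus_quat_def minus_quat_def quat_eq_iff)

end

lemma quat_sel_zero [simp]: "q1 0 = 0" "qi 0 = 0" "qj 0 = 0" "qk 0 = 0"
  by (simp_all add: zero_quat_def)

lemma quat_sel_add [simp]:
  "q1 (p + q) = q1 p + q1 q" "qi (p + q) = qi p + qi q"
  "qj (p + q) = qj p + qj q" "qk (p + q) = qk p + qk q"
  by (simp_all add: plus_quat_def)

lemma quat_sel_uminus [simp]:
  "q1 (- p) = - q1 p" "qi (- p) = - qi p" "qj (- p) = - qj p" "qk (- p) = - qk p"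
  by (simp_all add: uminus_quat_def)

lemma quat_sel_diff [simp]:
  "q1 (p - q) = q1 p - q1 q" "qi (p - q) = qi p - qi q"
  "qj (p - q) = qj p - qj q" "qk (p - q) = qk p - qk q"
  by (simp_all add: minus_quat_def)

instantiation quat :: ring_1
begin

definition "1 = Quat 1 0 0 0"
definition "p * q = Quat
  (q1 p * q1 q - qi p * qi q - qj p * qj q - qk p * qk q)
  (q1 p * qi q + qi p * q1 q + qj p * qk q - qk p * qj q)
  (q1 p * qj q - qi p * qk q + qj p * q1 q + qk p * qi q)
  (q1 p * qk q + qi p * qj q - qj p * qi q + qk p * q1 q)"

instance
  by standard (simp_all add: one_quat_def times_quat_def quat_eq_iff algebra_simps)

end

lemma quat_sel_one [simp]: "q1 1 = 1" "qi 1 = 0" "qj 1 = 0" "qk 1 = 0"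
  by (simp_all add: one_quat_def)

lemma quat_sel_mult [simp]:
  "q1 (p * q) = q1 p * q1 q - qi p * qi q - qj p * qj q - qk p * qk q"
  "qi (p * q) = q1 p * qi q + qi p * q1 q + qj p * qk q - qk p * qj q"
  "qj (p * q) = q1 p * qj q - qi p * qk q + qj p * q1 q + qk p * qi q"
  "qk (p * q) = q1 p * qk q + qi p * qj q - qj p * qi q + qk p * q1 q"
  by (simp_all add: times_quat_def)

instantiation quat :: real_algebra_1
begin

definition "scaleR r p = Quat (r * q1 p) (r * qi p) (r * qj p) (r * qk p)"

instance
  by standard (simp_all add: scaleR_quat_def quat_eq_iff algebra_simps)

end

lemma quat_sel_scaleR [simp]:
  "q1 (r *\<^sub>R p) = r * q1 p" "qi (r *\<^sub>R p) = r * qi p"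
  "qj (r *\<^sub>R p) = r * qj p" "qk (r *\<^sub>R p) = r * qk p"
  by (simp_all add: scaleR_quat_def)

definition quat_cnj :: "quat \<Rightarrow> quat" where
  "quat_cnj p = Quat (q1 p) (- qi p) (- qj p) (- qk p)"

lemma quat_sel_cnj [simp]:
  "q1 (quat_cnj p) = q1 p" "qi (quat_cnj p) = - qi p"
  "qj (quat_cnj p) = - qj p" "qk (quat_cnj p) = - qk p"
  by (simp_all add: quat_cnj_def)

instantiation quat :: real_inner
begin

definition "inner p q = q1 p * q1 q + qi p * qi q + qj p * qj q + qk p * qk q"
definition "norm (p::quat) = sqrt (inner p p)"
definition "sgn p = p /\<^sub>R norm p" for p :: quat
definition "dist p q = norm (p - q)" for p q :: quat
definition [code del]:
  "(uniformity :: (quat \<times> quat) filter) = (INF e\<in>{0 <..}. principal {(x, y). dist x y < e})"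
definition [code del]:
  "open (U :: quat set) \<longleftrightarrow> (\<forall>x\<in>U. eventually (\<lambda>(x', y). x' = x \<longrightarrow> y \<in> U) uniformity)"

instance
proof
  fix p q r :: quat and a :: real
  show "inner p q = inner q p" by (simp add: inner_quat_def algebra_simps)
  show "inner (p + q) r = inner p r + inner q r" by (simp add: inner_quat_def algebra_simps)
  show "inner (a *\<^sub>R p) q = a * inner p q" by (simp add: inner_quat_def algebra_simps)
  show "0 \<le> inner p p" by (simp add: inner_quat_def)
  show "inner p p = 0 \<longleftrightarrow> p = 0"
  proof
    assume "inner p p = 0"
    then have "(q1 p)\<^sup>2 + ((qi p)\<^sup>2 + ((qj p)\<^sup>2 + (qk p)\<^sup>2)) = 0"
      by (simp add: inner_quat_def power2_eq_square)
    then have "q1 p = 0 \<and> qi p = 0 \<and> qj p = 0 \<and> qk p = 0"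
      by (simp add: add_nonneg_eq_0_iff)
    then show "p = 0" by (simp add: quat_eq_iff)
  qed (simp add: inner_quat_def)
qed (rule norm_quat_def sgn_quat_def dist_quat_def uniformity_quat_def open_quat_def)+

end

lemma norm_quat_sq: "(norm (p::quat))\<^sup>2 = (q1 p)\<^sup>2 + (qi p)\<^sup>2 + (qj p)\<^sup>2 + (qk p)\<^sup>2"
  unfolding power2_norm_eq_inner by (simp add: inner_quat_def power2_eq_square)

lemma quat_cnj_mult: "quat_cnj (p * q) = quat_cnj q * quat_cnj p"
  by (simp add: quat_eq_iff)

lemma quat_mult_cnj:
  "p * quat_cnj p = of_real ((norm p)\<^sup>2)" "quat_cnj p * p = of_real ((norm p)\<^sup>2)"
  unfolding norm_quat_sq by (simp_all add: quat_eq_iff of_real_def power2_eq_square)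

instantiation quat :: real_normed_div_algebra
begin

definition "inverse p = quat_cnj p /\<^sub>R (norm p)\<^sup>2"
definition "p div q = p * inverse q" for p q :: quat

instance
proof
  fix p q :: quat
  show "norm (p * q) = norm p * norm q"
  proof (rule power2_eq_imp_eq)
    have "of_real ((norm (p * q))\<^sup>2) = p * (q * quat_cnj q) * quat_cnj p"
      by (simp only: quat_mult_cnj[symmetric] quat_cnj_mult mult.assoc)
    also have "\<dots> = of_real ((norm q)\<^sup>2) * (p * quat_cnj p)"
      by (simp only: quat_mult_cnj(1)[of q] of_real_def mult_scaleR_left mult_scaleR_right
          mult_1_right mult_1_left)
    also have "\<dots> = of_real ((norm q)\<^sup>2 * (norm p)\<^sup>2)"
      by (simp only: quat_mult_cnj(1)[of p] of_real_mult)
    finally show "(norm (p * q))\<^sup>2 = (norm p * norm q)\<^sup>2"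
      by (simp only: of_real_eq_iff power_mult_distrib mult.commute)
  qed simp_all
  show "p \<noteq> 0 \<Longrightarrow> inverse p * p = 1" "p \<noteq> 0 \<Longrightarrow> p * inverse p = 1"
    by (simp_all only: inverse_quat_def mult_scaleR_left mult_scaleR_right quat_mult_cnj)
      (simp_all add: of_real_def)
  show "p div q = p * inverse q" by (rule divide_quat_def)
  show "inverse 0 = (0::quat)" by (simp add: inverse_quat_def quat_eq_iff)
qed

end

instantiation quat :: euclidean_space
begin

definition "Basis = {Quat 1 0 0 0, Quat 0 1 0 0, Quat 0 0 1 0, Quat 0 0 0 1}"

instance
proof
  show "(Basis :: quat set) \<noteq> {}" "finite (Basis :: quat set)"
    by (simp_all add: Basis_quat_def)
  fix u v :: quat
  assume "u \<in> Basis" "v \<in> Basis"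
  then show "u \<bullet> v = (if u = v then 1 else 0)"
    unfolding Basis_quat_def by (elim insertE emptyE) (simp_all add: inner_quat_def)
next
  fix x :: quat
  show "(\<forall>u\<in>Basis. x \<bullet> u = 0) \<longleftrightarrow> x = 0"
    unfolding Basis_quat_def ball_simps quat_eq_iff[of x 0] by (simp add: inner_quat_def)
qed

end

section \<open>Slices and slice regular functions\<close>

definition quat_ball :: "quat set" (\<open>\<bool>\<close>) where
  "\<bool> = {q. norm q < 1}"

definition imag_sphere :: "quat set" (\<open>\<S>\<close>) where
  "\<S> = {q. q\<^sup>2 = - 1}"

definition slice :: "quat \<Rightarrow> quat set" where
  "slice I = {of_real x + of_real y * I | x y. True}"

text \<open>
  A function on the ball is represented by a total function on the quaternions; no notion below
  depends on its values outside \<open>\<bool>\<close>. The two partial derivatives of \<open>(x, y) \<mapsto> f (x + y I)\<close>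
  are \<open>fx\<close> and \<open>fy\<close>, and \<open>I\<close> multiplies on the left.
\<close>

definition slice_regular :: "(quat \<Rightarrow> quat) \<Rightarrow> bool" where
  "slice_regular f \<longleftrightarrow> (\<forall>I\<in>\<S>. \<exists>fx fy :: real \<times> real \<Rightarrow> quat.
     let D = {(x, y). of_real x + of_real y * I \<in> \<bool>} in
       continuous_on D fx \<and> continuous_on D fy \<and>
       (\<forall>(x, y)\<in>D.
          ((\<lambda>t. f (of_real t + of_real y * I)) has_vector_derivative fx (x, y)) (at x) \<and>
          ((\<lambda>t. f (of_real x + of_real t * I)) has_vector_derivative fy (x, y)) (at y) \<and>
          (1/2) *\<^sub>R (fx (x, y) + I * fy (x, y)) = 0))"

definition slice_preserving :: "(quat \<Rightarrow> quat) \<Rightarrow> bool" where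
  "slice_preserving f \<longleftrightarrow> (\<forall>I\<in>\<S>. f ` (slice I \<inter> \<bool>) \<subseteq> slice I)"

section \<open>Inner functions\<close>

text \<open>
  The surface measure of the unit 3-sphere, obtained from Lebesgue measure in polar coordinates:
  the area of \<open>A\<close> is 4 times the volume of the cone of all \<open>r u\<close> with \<open>0 < r < 1\<close> and \<open>u \<in> A\<close>.
\<close>

definition sphere_measure :: "quat measure" where
  "sphere_measure = scale_measure 4
     (distr (restrict_space lborel (\<bool> - {0})) (restrict_space borel (sphere 0 1)) sgn)"

lemma measurable_sgn_sphere:
  "sgn \<in> measurable (restrict_space lborel (\<bool> - {0})) (restrict_space borel (sphere 0 1 :: quat set))"
proof (rule measurable_restrict_space2)
  show "sgn \<in> space (restrict_space lborel (\<bool> - {0})) \<rightarrow> (sphere 0 1 :: quat set)"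
    by (auto simp: space_restrict_space norm_sgn)
  have "(\<lambda>x::quat. x /\<^sub>R norm x) \<in> borel_measurable lborel"
    by measurable
  then show "sgn \<in> borel_measurable (restrict_space lborel (\<bool> - {0}) :: quat measure)"
    by (intro measurable_restrict_space1) (simp add: sgn_div_norm[abs_def])
qed

definition inner_function :: "(quat \<Rightarrow> quat) \<Rightarrow> bool" where
  "inner_function f \<longleftrightarrow> slice_regular f \<and> f ` \<bool> \<subseteq> \<bool> \<and>
     (AE u in sphere_measure. \<exists>l. ((\<lambda>r. f (r *\<^sub>R u)) \<longlongrightarrow> l) (at_left 1) \<and> norm l = 1)"

section \<open>The Riemannian metric and its distance\<close>

text \<open>
  A slice containing \<open>w\<close> is unique unless \<open>w\<close> is real; \<open>metric_norm_eq\<close> below shows that the metric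
  does not depend on the choice.
\<close>

definition slice_unit :: "quat \<Rightarrow> quat" where
  "slice_unit w = (SOME I. I \<in> \<S> \<and> w \<in> slice I)"

definition slice_part :: "quat \<Rightarrow> quat \<Rightarrow> quat" where
  "slice_part I d = (d \<bullet> 1) *\<^sub>R 1 + (d \<bullet> I) *\<^sub>R I"

definition metric_norm :: "quat \<Rightarrow> quat \<Rightarrow> real" where
  "metric_norm w d = (let d\<^sub>1 = slice_part (slice_unit w) d; d\<^sub>2 = d - d\<^sub>1 in
     sqrt ((norm d\<^sub>1)\<^sup>2 / (1 - (norm w)\<^sup>2)\<^sup>2 + (norm d\<^sub>2)\<^sup>2 / (norm (1 - w\<^sup>2))\<^sup>2))"

text \<open>
  A \<^const>\<open>valid_path\<close> may have an unbounded derivative at its finitely many break points. Integrability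
  of the speed excludes curves of infinite length, to which \<^const>\<open>integral\<close> would assign length 0.
\<close>

definition admissible_curve :: "quat \<Rightarrow> quat \<Rightarrow> (real \<Rightarrow> quat) \<Rightarrow> bool" where
  "admissible_curve p q \<gamma> \<longleftrightarrow> valid_path \<gamma> \<and> path_image \<gamma> \<subseteq> \<bool> \<and>
     pathstart \<gamma> = p \<and> pathfinish \<gamma> = q \<and>
     (\<lambda>t. metric_norm (\<gamma> t) (vector_derivative \<gamma> (at t))) integrable_on {0..1}"

definition curve_length :: "(real \<Rightarrow> quat) \<Rightarrow> real" where
  "curve_length \<gamma> = integral {0..1} (\<lambda>t. metric_norm (\<gamma> t) (vector_derivative \<gamma> (at t)))"

definition dist_g :: "quat \<Rightarrow> quat \<Rightarrow> real" where
  "dist_g p q = (INF \<gamma>\<in>{\<gamma>. admissible_curve p q \<gamma>}. curve_length \<gamma>)"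

lemma imag_sphere_iff: "I \<in> \<S> \<longleftrightarrow> q1 I = 0 \<and> norm I = 1"
proof
  assume "I \<in> \<S>"
  then have sq: "I * I = - 1" by (simp add: imag_sphere_def power2_eq_square)
  then have "norm I * norm I = 1" by (metis norm_minus_cancel norm_mult norm_one)
  then have n: "norm I = 1" by (metis norm_ge_zero power2_eq_square real_sqrt_unique real_sqrt_one)
  have "q1 I * q1 I - qi I * qi I - qj I * qj I - qk I * qk I = - 1"
    using sq by (simp add: quat_eq_iff)
  moreover have "q1 I * q1 I + qi I * qi I + qj I * qj I + qk I * qk I = 1"
    using norm_quat_sq[of I] n by (simp add: power2_eq_square)
  ultimately have "q1 I * q1 I = 0" by linarith
  with n show "q1 I = 0 \<and> norm I = 1" by simp
next
  assume *: "q1 I = 0 \<and> norm I = 1"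
  then have "qi I * qi I + qj I * qj I + qk I * qk I = 1"
    using norm_quat_sq[of I] by (simp add: power2_eq_square)
  with * show "I \<in> \<S>"
    by (simp add: imag_sphere_def quat_eq_iff power2_eq_square)
qed

lemma imag_unit_inner:
  assumes "I \<in> \<S>"
  shows "1 \<bullet> I = 0" "I \<bullet> 1 = 0" "I \<bullet> I = 1" "(1::quat) \<bullet> 1 = 1"
proof -
  have *: "q1 I = 0" "norm I = 1" using assms by (simp_all add: imag_sphere_iff)
  show "I \<bullet> I = 1" using *(2) by (simp add: norm_eq_1)
  show "1 \<bullet> I = 0" "I \<bullet> 1 = 0" "(1::quat) \<bullet> 1 = 1" using *(1) by (simp_all add: inner_quat_def)
qed

lemma slice_eq_span: "slice I = {x *\<^sub>R 1 + y *\<^sub>R I | x y. True}"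
  by (simp add: slice_def of_real_def)

lemma slice_unit: "slice_unit w \<in> \<S>" "w \<in> slice (slice_unit w)"
proof -
  define v where "v = w - q1 w *\<^sub>R 1"
  have "\<exists>I. I \<in> \<S> \<and> w \<in> slice I"
  proof (cases "v = 0")
    case True
    then have "w = q1 w *\<^sub>R 1 + 0 *\<^sub>R Quat 0 1 0 0" by (simp add: v_def)
    moreover have "Quat 0 1 0 0 \<in> \<S>"
      by (simp add: imag_sphere_def quat_eq_iff power2_eq_square)
    ultimately show ?thesis unfolding slice_eq_span by blast
  next
    case False
    have "v /\<^sub>R norm v \<in> \<S>"
      using False by (simp add: imag_sphere_iff) (simp add: v_def)
    moreover have "w = q1 w *\<^sub>R 1 + norm v *\<^sub>R (v /\<^sub>R norm v)"
      using False by (simp add: v_def)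
    ultimately show ?thesis unfolding slice_eq_span by blast
  qed
  then have "slice_unit w \<in> \<S> \<and> w \<in> slice (slice_unit w)"
    unfolding slice_unit_def by (rule someI_ex)
  then show "slice_unit w \<in> \<S>" "w \<in> slice (slice_unit w)" by auto
qed

lemma slice_part_eq:
  assumes I: "I \<in> \<S>" and d1: "d\<^sub>1 \<in> slice I" and d2: "\<forall>v\<in>slice I. orthogonal d\<^sub>2 v"
  shows "slice_part I (d\<^sub>1 + d\<^sub>2) = d\<^sub>1"
proof -
  obtain x y where xy: "d\<^sub>1 = x *\<^sub>R 1 + y *\<^sub>R I" using d1 unfolding slice_eq_span by blast
  have "1 = 1 *\<^sub>R 1 + 0 *\<^sub>R I" "I = 0 *\<^sub>R 1 + 1 *\<^sub>R I" by simp_all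
  then have "1 \<in> slice I" "I \<in> slice I" unfolding slice_eq_span by blast+
  then have z: "d\<^sub>2 \<bullet> 1 = 0" "d\<^sub>2 \<bullet> I = 0" using d2 by (auto simp: orthogonal_def)
  then show ?thesis by (simp add: slice_part_def xy z inner_add_left imag_unit_inner[OF I])
qed

lemma norm_slice_part:
  assumes "I \<in> \<S>"
  shows "(norm d)\<^sup>2 = (norm (slice_part I d))\<^sup>2 + (norm (d - slice_part I d))\<^sup>2"
proof -
  note * = imag_unit_inner[OF assms]
  have "slice_part I d \<bullet> (d - slice_part I d) = 0"
    by (simp add: slice_part_def inner_add_left inner_add_right inner_diff_right *
        inner_commute[of 1 d] inner_commute[of I d])
  then show ?thesis
    using norm_add_Pythagorean[of "slice_part I d" "d - slice_part I d"]
    by (simp add: orthogonal_def)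
qed

lemma metric_norm_eq:
  assumes I: "I \<in> \<S>" and w: "w \<in> slice I"
    and d1: "d\<^sub>1 \<in> slice I" and d2: "\<forall>v\<in>slice I. orthogonal d\<^sub>2 v"
  shows "metric_norm w (d\<^sub>1 + d\<^sub>2)
    = sqrt ((norm d\<^sub>1)\<^sup>2 / (1 - (norm w)\<^sup>2)\<^sup>2 + (norm d\<^sub>2)\<^sup>2 / (norm (1 - w\<^sup>2))\<^sup>2)"
proof -
  define J where "J = slice_unit w"
  define d where "d = d\<^sub>1 + d\<^sub>2"
  have J: "J \<in> \<S>" "w \<in> slice J" using slice_unit by (simp_all add: J_def)
  have part: "slice_part I d = d\<^sub>1" using slice_part_eq[OF I d1 d2] by (simp add: d_def)
  then have d2': "d\<^sub>2 = d - slice_part I d" by (simp add: d_def)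
  obtain x y where xy: "w = x *\<^sub>R 1 + y *\<^sub>R I" using w unfolding slice_eq_span by blast
  obtain x' y' where xy': "w = x' *\<^sub>R 1 + y' *\<^sub>R J" using J unfolding slice_eq_span by blast
  have "q1 I = 0" "q1 J = 0" "norm I = 1" "norm J = 1" using I J by (simp_all add: imag_sphere_iff)
  then have "x = x'" using xy xy' by (metis add.right_neutral mult.right_neutral mult_zero_right
      quat_sel_add(1) quat_sel_one(1) quat_sel_scaleR(1))
  then have yy: "y *\<^sub>R I = y' *\<^sub>R J" using xy xy' by simp
  then have "\<bar>y\<bar> = \<bar>y'\<bar>" using \<open>norm I = 1\<close> \<open>norm J = 1\<close>
    by (metis mult.right_neutral norm_scaleR)
  show ?thesis
  proof (cases "y = 0")
    case False
    consider "y' = y" | "y' = - y" using \<open>\<bar>y\<bar> = \<bar>y'\<bar>\<close> by linarith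
    then have "J = I \<or> J = - I"
    proof cases
      case 1
      with yy False show ?thesis by simp
    next
      case 2
      with yy have "y *\<^sub>R I = y *\<^sub>R (- J)" by simp
      with False have "I = - J" by (simp only: scaleR_cancel_left) simp
      then show ?thesis by simp
    qed
    then have "slice_part J d = slice_part I d" by (auto simp: slice_part_def)
    then have "slice_part J d = d\<^sub>1" using part by (rule trans)
    then show ?thesis
      unfolding metric_norm_def J_def[symmetric] d_def[symmetric] Let_def
      by (simp only:) (simp only: d_def add_diff_cancel_left')
  next
    case True
    have w: "w = of_real x" using xy True by (simp add: of_real_def)
    have "norm (1 - w\<^sup>2) = norm (of_real (1 - x\<^sup>2) :: quat)" by (simp add: w)
    also have "\<dots> = \<bar>1 - x\<^sup>2\<bar>" by (rule norm_of_real)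
    finally have eq: "(norm (1 - w\<^sup>2))\<^sup>2 = (1 - (norm w)\<^sup>2)\<^sup>2" by (simp add: w)
    have "(norm (slice_part J d))\<^sup>2 + (norm (d - slice_part J d))\<^sup>2 = (norm d\<^sub>1)\<^sup>2 + (norm d\<^sub>2)\<^sup>2"
      using norm_slice_part[OF I, of d] norm_slice_part[OF J(1), of d]
      unfolding part d2'[unfolded part] by linarith
    then show ?thesis
      unfolding metric_norm_def J_def[symmetric] d_def[symmetric] Let_def eq
        add_divide_distrib[symmetric] by (rule arg_cong)
  qed
qed

end

theory Submission
  imports Defs "HOL-Complex_Analysis.Complex_Analysis" "HOL-Real_Asymp.Real_Asymp"
begin

text \<open>
  A slice regular function is a power series \<open>f q = (\<Sum>n. q ^ n * a n)\<close>
  (\<open>slice_regular_power_series\<close>). On the 2-sphere of all \<open>x + y I\<close> with \<open>z = x + i y\<close> fixed it is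
  therefore affine in \<open>I\<close>, namely \<open>f (x + y I) = b + I c\<close>, where the stem functions \<open>b\<close> and \<open>c\<close>
  depend on \<open>z\<close> alone (\<open>representation_formula\<close>). The function preserves slices exactly when all
  coefficients \<open>a n\<close> are real.

  Suppose that \<open>f\<close> is inner and Lipschitz. Turning \<open>I\<close> costs a distance of at most \<open>pi / 2\<close>, uniformly
  up to the boundary (\<open>dist_g_rotation\<close>), because the metric stays bounded in the directions
  orthogonal to the slice. Points that approach unit quaternions with different real parts, on the
  other hand, get infinitely far apart: the logarithm of \<open>(Re w - a)\<^sup>2 + (1 - \<bar>w\<bar>\<^sup>2)\<^sup>2\<close> is a Lipschitz
  function of \<open>w\<close> (\<open>boundary_gauge_le_exp_dist\<close>). So one radial limit of norm 1 at a boundary point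
  controls the whole 2-sphere through that point: the real part and the norm of \<open>b + I c\<close> have
  radial limits that do not depend on \<open>I\<close> (\<open>lipschitz_boundary_limit\<close>). Comparing \<open>I\<close> with \<open>- I\<close>
  gives, at almost every angle, that the imaginary part of \<open>c\<close> and the inner product of \<open>b\<close> with
  \<open>I c\<close> tend to 0.

  Each real component of \<open>c\<close> is a bounded sine series with coefficients that are components of the
  \<open>a n\<close>, and such a series with vanishing radial limits is zero (\<open>sine_series_coeffs_vanish\<close>). So
  \<open>a n\<close> is real for \<open>n \<ge> 1\<close>. Then \<open>c\<close> is real, the imaginary part of \<open>b\<close> is that of \<open>a 0\<close>, and
  the second limit says that \<open>c\<close> times the imaginary part of \<open>a 0\<close> tends to 0. If that imaginary
  part were nonzero, \<open>c\<close> would vanish for the same reason as before, and \<open>f\<close> would be a constant of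
  norm less than 1, which has no radial limits of norm 1.

  Conversely, a slice preserving \<open>f\<close> acts on every slice as one holomorphic self-map \<open>\<phi>\<close> of the disc
  that commutes with conjugation. The differential of \<open>f\<close> at \<open>x + y I\<close> multiplies the slice by
  \<open>\<phi>' z\<close> and its orthogonal complement by the real number \<open>Im (\<phi> z) / Im z\<close>. The infinitesimal
  Schwarz-Pick inequality at \<open>z\<close> bounds the first factor, and the two-point inequality for \<open>z\<close> and
  its conjugate bounds the second by exactly what the metric requires (\<open>metric_norm_contraction\<close>).
  As \<open>f\<close> is continuously differentiable, also across the real axis, it maps admissible curves to
  admissible curves and does not increase their length.
\<close>

section \<open>Slices as copies of the complex plane\<close>

text \<open>
  For \<open>I\<close> in \<open>\<S>\<close> this is an isometric isomorphism of algebras from the complex plane onto the slice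
  of \<open>I\<close>. It sends the real axis to the real quaternions, whatever \<open>I\<close> is.
\<close>

definition slice_point :: "quat \<Rightarrow> complex \<Rightarrow> quat" where
  "slice_point I z = of_real (Re z) + of_real (Im z) * I"

lemma imag_sphere_sq: "I \<in> \<S> \<Longrightarrow> I * I = - 1"
  by (simp add: imag_sphere_def power2_eq_square)

lemma imag_sphere_uminus: "I \<in> \<S> \<Longrightarrow> - I \<in> \<S>"
  by (simp add: imag_sphere_def)

lemma slice_point_add: "slice_point I (z + w) = slice_point I z + slice_point I w"
  by (simp add: slice_point_def algebra_simps)

lemma slice_point_mult:
  assumes "I \<in> \<S>"
  shows "slice_point I (z * w) = slice_point I z * slice_point I w"
proof -
  have "slice_point I z * slice_point I w
     = of_real (Re z * Re w) + of_real (Re z * Im w + Im z * Re w) * I + of_real (Im z * Im w) * (I * I)"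
    unfolding slice_point_def of_real_def by (simp add: algebra_simps)
  then show ?thesis
    by (simp add: imag_sphere_sq[OF assms] slice_point_def algebra_simps)
qed

lemma slice_point_scaleR: "slice_point I (r *\<^sub>R z) = r *\<^sub>R slice_point I z"
  by (simp add: slice_point_def of_real_def algebra_simps)

lemma slice_point_of_real [simp]: "slice_point I (of_real x) = of_real x"
  by (simp add: slice_point_def)

lemma slice_point_one [simp]: "slice_point I 1 = 1"
  by (simp add: slice_point_def)

lemma slice_point_power: "I \<in> \<S> \<Longrightarrow> slice_point I (z ^ n) = slice_point I z ^ n"
  by (induction n) (simp_all add: slice_point_mult)

lemma norm_slice_point:
  assumes "I \<in> \<S>"
  shows "norm (slice_point I z) = norm z"
proof -
  have "q1 I = 0" "(qi I)\<^sup>2 + (qj I)\<^sup>2 + (qk I)\<^sup>2 = 1"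
    using assms norm_quat_sq[of I] by (simp_all add: imag_sphere_iff)
  moreover have "(norm (slice_point I z))\<^sup>2
      = (Re z)\<^sup>2 + (Im z)\<^sup>2 * ((qi I)\<^sup>2 + (qj I)\<^sup>2 + (qk I)\<^sup>2)" if "q1 I = 0"
    unfolding norm_quat_sq slice_point_def of_real_def using that
    by (simp add: power2_eq_square algebra_simps)
  ultimately have "(norm (slice_point I z))\<^sup>2 = (norm z)\<^sup>2"
    by (simp add: cmod_power2)
  then show ?thesis by simp
qed

lemma slice_point_in_ball: "I \<in> \<S> \<Longrightarrow> slice_point I z \<in> \<bool> \<longleftrightarrow> norm z < 1"
  by (simp add: quat_ball_def norm_slice_point)

lemma slice_point_in_slice: "slice_point I z \<in> slice I"
  by (auto simp: slice_def slice_point_def)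

lemma slice_eq_range: "slice I = range (slice_point I)"
proof -
  have "of_real x + of_real y * I = slice_point I (Complex x y)" for x y
    by (simp add: slice_point_def)
  then have "slice I \<subseteq> range (slice_point I)" unfolding slice_def by blast
  then show ?thesis using slice_point_in_slice by blast
qed

lemma bounded_linear_slice_point: "I \<in> \<S> \<Longrightarrow> bounded_linear (slice_point I)"
  by (rule bounded_linear_intro[where K = 1])
    (simp_all add: slice_point_add slice_point_scaleR norm_slice_point)

lemma quat_in_slice: obtains I z where "I \<in> \<S>" "q = slice_point I z"
  using slice_unit[of q] unfolding slice_eq_range by blast

text \<open>
  Left multiplication by \<open>I\<close> makes the quaternions a complex vector space, and \<open>L\<close> is a complex
  linear functional on it. Continuity of the partial derivatives makes the restriction of \<open>f\<close> to the
  slice totally differentiable, and the Cauchy-Riemann equation makes the differential complex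
  linear, so that every such \<open>L\<close> turns it into an ordinary holomorphic function.
\<close>

lemma holomorphic_slice_coordinate:
  assumes f: "slice_regular f" and I: "I \<in> \<S>"
    and L: "bounded_linear L" "\<And>h. L (I * h) = \<i> * L h"
  shows "(\<lambda>z. L (f (slice_point I z))) holomorphic_on ball 0 1"
proof -
  define D where "D = {(x, y). of_real x + of_real y * I \<in> \<bool>}"
  obtain fx fy :: "real \<times> real \<Rightarrow> quat"
    where c: "continuous_on D fx" "continuous_on D fy"
      and d: "\<And>x y. (x, y) \<in> D \<Longrightarrow>
          ((\<lambda>t. f (of_real t + of_real y * I)) has_vector_derivative fx (x, y)) (at x) \<and>
          ((\<lambda>t. f (of_real x + of_real t * I)) has_vector_derivative fy (x, y)) (at y) \<and>
          (1/2) *\<^sub>R (fx (x, y) + I * fy (x, y)) = 0"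
    using f I unfolding slice_regular_def D_def Let_def by blast
  have D: "(x, y) \<in> D \<longleftrightarrow> norm (Complex x y) < 1" for x y
    using slice_point_in_ball[OF I, of "Complex x y"] by (simp add: D_def slice_point_def)
  have openD: "open D"
  proof -
    have "D = (\<lambda>p. Complex (fst p) (snd p)) -` ball 0 1"
      using D by auto
    moreover have "continuous_on UNIV (\<lambda>p. Complex (fst p) (snd p))"
      by (intro continuous_intros)
    ultimately show ?thesis using open_vimage by blast
  qed
  have "(\<lambda>z. L (f (slice_point I z))) field_differentiable at z" if z: "z \<in> ball 0 1" for z
  proof -
    define x y where "x = Re z" and "y = Im z"
    have xy: "(x, y) \<in> D" using z D by (simp add: x_def y_def)
    obtain X Y where XY: "open X" "open Y" "x \<in> X" "y \<in> Y" "X \<times> Y \<subseteq> D"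
      using open_prod_elim[OF openD xy] by (metis mem_Sigma_iff)
    then obtain e where e: "e > 0" "ball y e \<subseteq> Y" using open_contains_ball by blast
    define Y' where "Y' = ball y e"
    have sub: "X \<times> Y' \<subseteq> D" using XY e by (auto simp: Y'_def)
    have opn: "open (X \<times> Y')" using XY by (auto simp: Y'_def intro: open_Times)
    define g where "g = (\<lambda>x y. f (of_real x + of_real y * I))"
    have "((\<lambda>(x, y). g x y) has_derivative
        (\<lambda>(tx, ty). tx *\<^sub>R fx (x, y) + blinfun_scaleR_left (fy (x, y)) ty)) (at (x, y) within X \<times> Y')"
    proof (rule has_derivative_partialsI)
      show "((\<lambda>x. g x y) has_derivative (\<lambda>tx. tx *\<^sub>R fx (x, y))) (at x within X)"
        using d[OF xy] unfolding g_def has_vector_derivative_def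
        by (auto intro: has_derivative_at_withinI)
      show "((\<lambda>y. g x y) has_derivative blinfun_apply (blinfun_scaleR_left (fy (x, y)))) (at y within Y')"
        if "x \<in> X" "y \<in> Y'" for x y
      proof -
        have "(x, y) \<in> D" using that sub by blast
        then have "((\<lambda>t. g x t) has_vector_derivative fy (x, y)) (at y)"
          using d unfolding g_def by blast
        then show ?thesis
          unfolding has_vector_derivative_def blinfun_scaleR_left.rep_eq
          by (rule has_derivative_at_withinI)
      qed
      have "continuous (at (x, y) within X \<times> Y') fy"
        using c(2) xy openD by (simp add: continuous_at_imp_continuous_at_within continuous_on_eq_continuous_at)
      then have "continuous (at (x, y) within X \<times> Y') (\<lambda>p. blinfun_scaleR_left (fy p))"
        by (rule bounded_linear.continuous[OF bounded_linear_blinfun_scaleR_left])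
      then show "continuous (at (x, y) within X \<times> Y') (\<lambda>(x, y). blinfun_scaleR_left (fy (x, y)))"
        by (simp add: case_prod_unfold)
      show "y \<in> Y'" "convex Y'" using e by (simp_all add: Y'_def)
    qed
    then have "((\<lambda>(x, y). g x y) has_derivative
        (\<lambda>(tx, ty). tx *\<^sub>R fx (x, y) + ty *\<^sub>R fy (x, y))) (at (x, y))"
      using at_within_open[OF _ opn] XY e by (simp add: Y'_def)
    moreover have "((\<lambda>w. (Re w, Im w)) has_derivative (\<lambda>w. (Re w, Im w))) (at z)"
      by (intro derivative_intros bounded_linear_imp_has_derivative
          bounded_linear_Pair bounded_linear_Re bounded_linear_Im)
    ultimately have "((\<lambda>w. g (Re w) (Im w)) has_derivative
        (\<lambda>w. Re w *\<^sub>R fx (x, y) + Im w *\<^sub>R fy (x, y))) (at z)"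
      using has_derivative_compose[of "\<lambda>w. (Re w, Im w)" "\<lambda>w. (Re w, Im w)" z UNIV "\<lambda>(x, y). g x y"
        "\<lambda>(tx, ty). tx *\<^sub>R fx (x, y) + ty *\<^sub>R fy (x, y)"]
      by (simp add: x_def y_def)
    then have "((\<lambda>w. L (g (Re w) (Im w))) has_derivative
        (\<lambda>w. L (Re w *\<^sub>R fx (x, y) + Im w *\<^sub>R fy (x, y)))) (at z)"
      by (rule bounded_linear.has_derivative[OF L(1)])
    moreover have "L (Re w *\<^sub>R fx (x, y) + Im w *\<^sub>R fy (x, y)) = L (fx (x, y)) * w" for w
    proof -
      have "fx (x, y) + I * fy (x, y) = 0" using d[OF xy] by simp
      \<comment> \<open>The equation \<open>fx + I * fy = 0\<close> is solved for \<open>fy\<close> by multiplying with \<open>I\<close>.\<close>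
      then have "I * (fx (x, y) + I * fy (x, y)) = 0" by simp
      then have "I * fx (x, y) + (I * I) * fy (x, y) = 0" by (simp add: algebra_simps)
      then have "fy (x, y) = I * fx (x, y)" by (simp add: imag_sphere_sq[OF I])
      then have "L (Re w *\<^sub>R fx (x, y) + Im w *\<^sub>R fy (x, y))
         = Re w *\<^sub>R L (fx (x, y)) + Im w *\<^sub>R (\<i> * L (fx (x, y)))"
        using L(1)[THEN bounded_linear.linear] by (simp add: linear_add linear_scale L(2))
      also have "\<dots> = (Re w + \<i> * Im w) * L (fx (x, y))"
        by (simp add: scaleR_conv_of_real algebra_simps)
      finally show ?thesis by (metis complex_eq mult.commute)
    qed
    ultimately have "((\<lambda>w. L (g (Re w) (Im w))) has_field_derivative L (fx (x, y))) (at z)"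
      by (simp add: has_field_derivative_def)
    then show ?thesis
      unfolding g_def slice_point_def field_differentiable_def by blast
  qed
  then show ?thesis by (simp add: holomorphic_on_open field_differentiable_def)
qed

lemma quat_i_unit: "Quat 0 1 0 0 \<in> \<S>"
  by (simp add: imag_sphere_def quat_eq_iff power2_eq_square)

lemma quat_j_unit: "Quat 0 0 1 0 \<in> \<S>"
  by (simp add: imag_sphere_def quat_eq_iff power2_eq_square)

lemma quat_k_unit: "Quat 0 0 0 1 \<in> \<S>"
  by (simp add: imag_sphere_def quat_eq_iff power2_eq_square)

lemma abs_quat_sel_le_norm:
  "\<bar>q1 q\<bar> \<le> norm q" "\<bar>qi q\<bar> \<le> norm q" "\<bar>qj q\<bar> \<le> norm q" "\<bar>qk q\<bar> \<le> norm q"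
proof -
  have "\<bar>x\<bar> \<le> norm q" if "x\<^sup>2 \<le> (norm q)\<^sup>2" for x
    using that abs_le_square_iff[of x "norm q"] by simp
  then show "\<bar>q1 q\<bar> \<le> norm q" "\<bar>qi q\<bar> \<le> norm q" "\<bar>qj q\<bar> \<le> norm q" "\<bar>qk q\<bar> \<le> norm q"
    by (simp_all add: norm_quat_sq)
qed

lemma bounded_linear_quat_sel:
  "bounded_linear q1" "bounded_linear qi" "bounded_linear qj" "bounded_linear qk"
proof -
  have "\<bar>x\<bar> \<le> norm q * 1" if "x\<^sup>2 \<le> (norm q)\<^sup>2" for x and q :: quat
    using that abs_le_square_iff[of x "norm q"] by simp
  then show "bounded_linear q1" "bounded_linear qi" "bounded_linear qj" "bounded_linear qk"
    by (auto intro!: bounded_linear_intro[where K = 1] simp: norm_quat_sq)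
qed

section \<open>Power series and stem functions\<close>

lemma zero_islimpt_real_segment: "(0::complex) islimpt of_real ` {-1<..<1}"
  unfolding islimpt_approachable
proof (intro allI impI)
  fix e :: real assume "e > 0"
  then show "\<exists>x'\<in>of_real ` {-1<..<1}. x' \<noteq> 0 \<and> dist x' (0::complex) < e"
    by (intro bexI[of _ "of_real (min e 1 / 2)"] imageI)
      (auto simp: dist_norm simp del: of_real_divide)
qed

text \<open>
  Between \<open>r\<close> and 1 there is a real point \<open>s\<close>. The terms of the series at \<open>s\<close> are bounded because
  they tend to 0, so at \<open>r\<close> they are dominated by a geometric series of ratio \<open>r / s\<close>.
\<close>

lemma real_axis_norm_summable:
  fixes a :: "nat \<Rightarrow> quat"
  assumes S: "\<And>x::real. 0 \<le> x \<Longrightarrow> x < 1 \<Longrightarrow> summable (\<lambda>n. of_real x ^ n * a n)" and r: "0 \<le> r" "r < 1"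
  shows "summable (\<lambda>n. norm (a n) * r ^ n)"
proof -
  define s where "s = (1 + r) / 2"
  have s: "r < s" "s < 1" "0 < s" using r by (auto simp: s_def)
  have "(\<lambda>n. of_real s ^ n * a n) \<longlonglongrightarrow> 0"
    using S[of s] s by (simp add: summable_LIMSEQ_zero)
  then have "Bseq (\<lambda>n. of_real s ^ n * a n)" by (meson convergentI convergent_imp_Bseq)
  then obtain M where M: "\<And>n. norm (of_real s ^ n * a n) \<le> M" by (auto simp: Bseq_def)
  have "norm (norm (a n) * r ^ n) \<le> M * (r / s) ^ n" for n
  proof -
    have "norm (a n) * r ^ n = norm (of_real s ^ n * a n) * (r / s) ^ n"
      using s by (simp add: norm_mult norm_power power_divide)
    also have "\<dots> \<le> M * (r / s) ^ n"
      using r s by (intro mult_right_mono M) auto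
    finally show ?thesis using r by simp
  qed
  moreover have "summable (\<lambda>n. M * (r / s) ^ n)"
    using r s by (intro summable_mult summable_geometric) auto
  ultimately show ?thesis by (rule summable_comparison_test'[rotated])
qed

lemma powser_norm_summable:
  assumes S: "\<And>q. q \<in> \<bool> \<Longrightarrow> (\<lambda>n. q ^ n * a n) sums f q" and r: "0 \<le> r" "r < 1"
  shows "summable (\<lambda>n. norm (a n) * r ^ n)"
proof (rule real_axis_norm_summable[OF _ r])
  fix x :: real assume "0 \<le> x" "x < 1"
  then have "(of_real x :: quat) \<in> \<bool>" by (simp add: quat_ball_def)
  then show "summable (\<lambda>n. of_real x ^ n * a n)" using S sums_summable by blast
qed

lemma slice_powser_abs_summable:
  fixes a :: "nat \<Rightarrow> quat"
  assumes "\<And>r. 0 \<le> r \<Longrightarrow> r < 1 \<Longrightarrow> summable (\<lambda>n. norm (a n) * r ^ n)" and "q \<in> \<bool>"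
  shows "summable (\<lambda>n. q ^ n * a n)"
proof (rule summable_norm_cancel)
  show "summable (\<lambda>n. norm (q ^ n * a n))"
    using assms(1)[of "norm q"] assms(2)
    by (simp add: norm_mult norm_power quat_ball_def mult.commute)
qed

text \<open>
  On the slice of the unit \<open>i\<close>, write the values as \<open>F + G j\<close> with \<open>F\<close> and \<open>G\<close> in that slice; both
  coordinates are holomorphic, and their Taylor coefficients combine to \<open>a\<close>. On any other slice,
  \<open>f\<close> and the sum of the series are holomorphic in every complex linear coordinate, and they agree on
  the real axis because it lies in all slices. The identity theorem extends the agreement to the
  whole slice.
\<close>

theorem slice_regular_power_series:
  assumes f: "slice_regular f"
  obtains a where "\<And>q. q \<in> \<bool> \<Longrightarrow> (\<lambda>n. q ^ n * a n) sums f q"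
proof -
  define i j where "i = Quat 0 1 0 0" and "j = Quat 0 0 1 0"
  have i: "i \<in> \<S>" using quat_i_unit by (simp add: i_def)
  define L1 L2 where "L1 = (\<lambda>h. Complex (q1 h) (qi h))" and "L2 = (\<lambda>h. Complex (qj h) (qk h))"
  have "norm (L1 h) \<le> norm h * 2" "norm (L2 h) \<le> norm h * 2" for h
    using cmod_le[of "L1 h"] cmod_le[of "L2 h"] abs_quat_sel_le_norm[of h]
    by (simp_all add: L1_def L2_def)
  then have bl: "bounded_linear L1" "bounded_linear L2"
    by (auto intro!: bounded_linear_intro[where K = 2] simp: L1_def L2_def complex_eq_iff)
  have Li: "L1 (i * h) = \<i> * L1 h" "L2 (i * h) = \<i> * L2 h" for h
    by (simp_all add: L1_def L2_def i_def complex_eq_iff)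
  have split: "h = slice_point i (L1 h) + slice_point i (L2 h) * j" for h
    by (simp add: slice_point_def L1_def L2_def i_def j_def quat_eq_iff of_real_def)
  define c where "c = (\<lambda>L::quat \<Rightarrow> complex. \<lambda>n. (deriv ^^ n) (\<lambda>z. L (f (slice_point i z))) 0 / fact n)"
  have c: "(\<lambda>n. c L n * z ^ n) sums L (f (slice_point i z))"
    if "norm z < 1" "bounded_linear L" "\<And>h. L (i * h) = \<i> * L h" for z L
    unfolding c_def
    using holomorphic_power_series[OF holomorphic_slice_coordinate[OF f i that(2,3)], of z] that
    by simp
  define a where "a = (\<lambda>n. slice_point i (c L1 n) + slice_point i (c L2 n) * j)"
  have sum_i: "(\<lambda>n. slice_point i z ^ n * a n) sums f (slice_point i z)" if z: "norm z < 1" for z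
  proof -
    have "(\<lambda>n. slice_point i (c L1 n * z ^ n) + slice_point i (c L2 n * z ^ n) * j) sums
        (slice_point i (L1 (f (slice_point i z))) + slice_point i (L2 (f (slice_point i z))) * j)"
      by (intro sums_add sums_mult2 bounded_linear.sums[OF bounded_linear_slice_point[OF i]]
          c z bl Li)
    moreover have "slice_point i (c L n * z ^ n) = slice_point i z ^ n * slice_point i (c L n)" for L n
      by (simp add: slice_point_mult[OF i, symmetric] slice_point_power[OF i, symmetric] mult.commute)
    ultimately show ?thesis
      by (simp add: a_def distrib_left mult.assoc flip: split)
  qed
  have norm_a: "summable (\<lambda>n. norm (a n) * r ^ n)" if "0 \<le> r" "r < 1" for r
  proof (rule real_axis_norm_summable[OF _ that])
    fix x :: real assume "0 \<le> x" "x < 1"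
    then show "summable (\<lambda>n. of_real x ^ n * a n)"
      using sum_i[of "of_real x"] by (auto dest: sums_summable)
  qed
  have "(\<lambda>n. q ^ n * a n) sums f q" if q: "q \<in> \<bool>" for q
  proof -
    obtain I z where I: "I \<in> \<S>" and qz: "q = slice_point I z" by (rule quat_in_slice)
    have z: "norm z < 1" using q qz slice_point_in_ball[OF I] by simp
    define g where "g = (\<lambda>q. \<Sum>n. q ^ n * a n)"
    have g: "(\<lambda>n. q ^ n * a n) sums g q" if "q \<in> \<bool>" for q
      unfolding g_def by (rule summable_sums[OF slice_powser_abs_summable[OF norm_a that]])
    \<comment> \<open>The complex linear functional with real part \<open>h \<bullet> e\<close>; taking \<open>e = f q - g q\<close> will give \<open>f q = g q\<close>.\<close>
    have "Complex ((f q - g q) \<bullet> e) (- ((I * (f q - g q)) \<bullet> e)) = 0" for e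
    proof -
      define L where "L = (\<lambda>h. Complex (h \<bullet> e) (- ((I * h) \<bullet> e)))"
      have L: "bounded_linear L"
      proof (rule bounded_linear_intro[where K = "2 * norm e"])
        fix h
        have "cmod (L h) \<le> \<bar>h \<bullet> e\<bar> + \<bar>(I * h) \<bullet> e\<bar>"
          by (rule order_trans[OF cmod_le]) (simp add: L_def)
        also have "\<dots> \<le> norm h * norm e + norm (I * h) * norm e"
          by (intro add_mono Cauchy_Schwarz_ineq2)
        finally show "cmod (L h) \<le> norm h * (2 * norm e)"
          using I by (simp add: norm_mult imag_sphere_iff algebra_simps)
      qed (simp_all add: L_def complex_eq_iff algebra_simps inner_add_left)
      have LI: "L (I * h) = \<i> * L h" for h
      proof -
        have "I * (I * h) = - h" using imag_sphere_sq[OF I] by (simp flip: mult.assoc)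
        then show ?thesis by (simp add: L_def complex_eq_iff)
      qed
      have Lpow: "L (slice_point I w * h) = w * L h" for w h
      proof -
        have "slice_point I w * h = Re w *\<^sub>R h + Im w *\<^sub>R (I * h)"
          by (simp add: slice_point_def of_real_def algebra_simps)
        then have "L (slice_point I w * h) = Re w *\<^sub>R L h + Im w *\<^sub>R L (I * h)"
          using bounded_linear.linear[OF L] by (simp add: linear_add linear_scale)
        also have "\<dots> = (of_real (Re w) + \<i> * of_real (Im w)) * L h"
          by (simp add: LI scaleR_conv_of_real algebra_simps)
        finally show ?thesis by (simp flip: complex_eq)
      qed
      have Lg: "(\<lambda>n. L (a n) * (w - 0) ^ n) sums L (g (slice_point I w))" if "w \<in> ball 0 1" for w
      proof -
        have "slice_point I w \<in> \<bool>" using that slice_point_in_ball[OF I] by simp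
        from bounded_linear.sums[OF L g[OF this]]
        show ?thesis by (simp add: slice_point_power[OF I, symmetric] Lpow mult.commute)
      qed
      have "(\<lambda>w. L (f (slice_point I w)) - L (g (slice_point I w))) holomorphic_on ball 0 1"
        by (intro holomorphic_on_diff holomorphic_slice_coordinate f I L LI power_series_holomorphic[OF Lg])
      then have "L (f (slice_point I z)) - L (g (slice_point I z)) = 0"
      proof (rule analytic_continuation[where U = "of_real ` {-1<..<1}" and \<xi> = 0])
        show "(0::complex) islimpt of_real ` {-1<..<1}" by (rule zero_islimpt_real_segment)
        fix w :: complex assume "w \<in> of_real ` {-1<..<1}"
        then obtain x where x: "w = of_real x" "\<bar>x\<bar> < 1" by auto
        have "(\<lambda>n. of_real x ^ n * a n) sums f (of_real x)"
          using sum_i[of "of_real x"] x by simp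
        moreover have "(\<lambda>n. of_real x ^ n * a n) sums g (of_real x)"
          using x by (intro g) (simp add: quat_ball_def)
        ultimately show "L (f (slice_point I w)) - L (g (slice_point I w)) = 0"
          using x sums_unique2 by fastforce
      qed (use z in auto)
      then have "L (f q - g q) = 0"
        using bounded_linear.linear[OF L] by (simp add: qz linear_diff)
      then show ?thesis by (simp add: L_def)
    qed
    from this[of "f q - g q"] have "f q = g q" by (simp add: complex_eq_iff)
    with g[OF q] show ?thesis by simp
  qed
  then show ?thesis by (rule that)
qed

text \<open>
  Evaluating the series with coefficients \<open>a\<close> at a complex number \<open>z\<close> that commutes with the
  quaternions, that is, in the complexified quaternions, gives \<open>stem_re a z + i * stem_im a z\<close>.
\<close>

definition stem_re :: "(nat \<Rightarrow> quat) \<Rightarrow> complex \<Rightarrow> quat" where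
  "stem_re a z = (\<Sum>n. Re (z ^ n) *\<^sub>R a n)"

definition stem_im :: "(nat \<Rightarrow> quat) \<Rightarrow> complex \<Rightarrow> quat" where
  "stem_im a z = (\<Sum>n. Im (z ^ n) *\<^sub>R a n)"

lemma stem_sums:
  assumes S: "\<And>q. q \<in> \<bool> \<Longrightarrow> (\<lambda>n. q ^ n * a n) sums f q" and z: "norm z < 1"
  shows "(\<lambda>n. Re (z ^ n) *\<^sub>R a n) sums stem_re a z" "(\<lambda>n. Im (z ^ n) *\<^sub>R a n) sums stem_im a z"
proof -
  have s: "summable (\<lambda>n. norm (a n) * norm z ^ n)"
    using powser_norm_summable[OF S _ z] by simp
  have "summable (\<lambda>n. Re (z ^ n) *\<^sub>R a n)" "summable (\<lambda>n. Im (z ^ n) *\<^sub>R a n)"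
    by (rule summable_comparison_test'[OF s, of 0];
        simp add: mult.commute mult_left_mono abs_Re_le_cmod abs_Im_le_cmod flip: norm_power)+
  then show "(\<lambda>n. Re (z ^ n) *\<^sub>R a n) sums stem_re a z" "(\<lambda>n. Im (z ^ n) *\<^sub>R a n) sums stem_im a z"
    by (simp_all add: stem_re_def stem_im_def summable_sums)
qed

text \<open>
  With \<open>q = slice_point I z\<close>, the power \<open>q ^ n\<close> equals \<open>Re (z ^ n) + Im (z ^ n) * I\<close>, so that \<open>I\<close>
  can be taken out of the sum.
\<close>

lemma representation_formula:
  assumes S: "\<And>q. q \<in> \<bool> \<Longrightarrow> (\<lambda>n. q ^ n * a n) sums f q" and z: "norm z < 1" and I: "I \<in> \<S>"
  shows "f (slice_point I z) = stem_re a z + I * stem_im a z"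
proof -
  have "slice_point I z ^ n * a n = Re (z ^ n) *\<^sub>R a n + I * (Im (z ^ n) *\<^sub>R a n)" for n
    unfolding slice_point_power[OF I, symmetric]
    by (simp add: slice_point_def of_real_def algebra_simps)
  then have "(\<lambda>n. slice_point I z ^ n * a n) sums (stem_re a z + I * stem_im a z)"
    using sums_add[OF stem_sums(1)[OF S z] sums_mult[OF stem_sums(2)[OF S z], of I]] by simp
  moreover have "slice_point I z \<in> \<bool>" using z by (simp add: slice_point_in_ball I)
  ultimately show ?thesis using S sums_unique2 by blast
qed

section \<open>Sine series with vanishing radial limits\<close>

lemma sin_orthogonal:
  fixes m n :: nat
  assumes n: "n \<ge> 1"
  defines "M \<equiv> restrict_space lborel {0..pi}"
  shows "integral\<^sup>L M (\<lambda>\<theta>. sin (real m * \<theta>) * sin (real n * \<theta>)) = (if m = n then pi / 2 else 0)"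
proof -
  \<comment> \<open>The antiderivative that comes from writing the product as a difference of two cosines.\<close>
  define F where "F = (\<lambda>\<theta>::real. if m = n then \<theta> / 2 - sin (2 * n * \<theta>) / (4 * n)
    else (sin ((real m - real n) * \<theta>) / (real m - real n) - sin ((real m + real n) * \<theta>) / (real m + real n)) / 2)"
  have mn: "real m + real n \<noteq> 0" "real n \<noteq> 0" using n by simp_all
  have der: "(F has_real_derivative sin (real m * \<theta>) * sin (real n * \<theta>)) (at \<theta>)" for \<theta>
  proof (cases "m = n")
    case True
    have "cos (2 * n * \<theta>) = 1 - 2 * (sin (real n * \<theta>))\<^sup>2"
      using cos_double_sin[of "n * \<theta>"] by (simp add: mult.assoc)
    then have "1 / 2 - cos (2 * n * \<theta>) * (2 * n) / (4 * n) = sin (real m * \<theta>) * sin (real n * \<theta>)"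
      using mn True by (simp add: field_simps power2_eq_square)
    moreover have "((\<lambda>\<theta>. \<theta> / 2 - sin (2 * n * \<theta>) / (4 * n)) has_real_derivative
        1 / 2 - cos (2 * n * \<theta>) * (2 * n) / (4 * n)) (at \<theta>)"
      by (auto intro!: derivative_eq_intros)
    ultimately show ?thesis using True by (simp add: F_def)
  next
    case False
    then have d: "real m - real n \<noteq> 0" by simp
    have "(cos ((real m - real n) * \<theta>) - cos ((real m + real n) * \<theta>)) / 2 = sin (real m * \<theta>) * sin (real n * \<theta>)"
      by (simp add: distrib_right left_diff_distrib cos_add cos_diff)
    moreover have "((\<lambda>\<theta>. (sin ((real m - real n) * \<theta>) / (real m - real n)
        - sin ((real m + real n) * \<theta>) / (real m + real n)) / 2) has_real_derivative
        (cos ((real m - real n) * \<theta>) - cos ((real m + real n) * \<theta>)) / 2) (at \<theta>)"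
      by (rule derivative_eq_intros refl | use d mn in \<open>simp; fail\<close>)+
    ultimately show ?thesis using False by (simp add: F_def)
  qed
  have "integral\<^sup>L M (\<lambda>\<theta>. sin (real m * \<theta>) * sin (real n * \<theta>))
      = (\<integral>\<theta>. (sin (real m * \<theta>) * sin (real n * \<theta>)) * indicator {0..pi} \<theta> \<partial>lborel)"
    unfolding M_def by (subst integral_restrict_space) (simp_all add: mult.commute)
  also have "\<dots> = F pi - F 0"
    by (rule integral_FTC_Icc_real) (rule pi_ge_zero der | intro continuous_intros)+
  also have "\<dots> = (if m = n then pi / 2 else 0)"
    using sin_npi[of m] sin_npi[of n] sin_npi[of "2 * n"]
    by (simp add: F_def distrib_right left_diff_distrib sin_add sin_diff)
  finally show ?thesis .
qed

text \<open>
  For \<open>r < 1\<close>, integrating the series against \<open>sin (n * \<theta>)\<close> over \<open>[0, pi]\<close> gives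
  \<open>pi / 2 * \<alpha> n * r ^ n\<close>. As \<open>r\<close> tends to 1 the integrands stay bounded by \<open>B\<close> and tend to 0
  almost everywhere, so by dominated convergence the integrals tend to 0.
\<close>

lemma sine_series_coeffs_vanish:
  fixes \<alpha> :: "nat \<Rightarrow> real"
  assumes summ: "\<And>r. 0 \<le> r \<Longrightarrow> r < 1 \<Longrightarrow> summable (\<lambda>n. \<bar>\<alpha> n\<bar> * r ^ n)"
    and bd: "\<And>r \<theta>. 0 \<le> r \<Longrightarrow> r < 1 \<Longrightarrow> \<bar>\<Sum>n. \<alpha> n * r ^ n * sin (real n * \<theta>)\<bar> \<le> B"
    and lim: "AE \<theta> in lborel. 0 < \<theta> \<and> \<theta> < pi \<longrightarrow>
        ((\<lambda>r. \<Sum>n. \<alpha> n * r ^ n * sin (real n * \<theta>)) \<longlongrightarrow> 0) (at_left 1)"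
    and n: "n \<ge> 1"
  shows "\<alpha> n = 0"
proof -
  define M where "M = restrict_space lborel {0..pi}"
  interpret finite_measure M
    unfolding M_def by (rule finite_measureI) (simp add: space_restrict_space emeasure_restrict_space)
  define u :: "real \<Rightarrow> real \<Rightarrow> real" where "u = (\<lambda>r \<theta>. \<Sum>m. \<alpha> m * r ^ m * sin (real m * \<theta>))"
  have meas: "f \<in> borel_measurable M" if "f \<in> borel_measurable borel" for f :: "real \<Rightarrow> real"
    using that unfolding M_def by (intro measurable_restrict_space1) simp
  have u_meas: "u r \<in> borel_measurable M" for r
    unfolding u_def by (rule meas) measurable
  have coeff: "integral\<^sup>L M (\<lambda>\<theta>. u r \<theta> * sin (real n * \<theta>)) = pi / 2 * (\<alpha> n * r ^ n)"
    if r: "0 \<le> r" "r < 1" for r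
  proof -
    define f :: "nat \<Rightarrow> real \<Rightarrow> real" where "f = (\<lambda>m \<theta>. \<alpha> m * r ^ m * (sin (real m * \<theta>) * sin (real n * \<theta>)))"
    have f_le: "norm (f m \<theta>) \<le> \<bar>\<alpha> m\<bar> * r ^ m" for m \<theta>
    proof -
      have "\<bar>sin (real m * \<theta>) * sin (real n * \<theta>)\<bar> \<le> 1 * 1"
        unfolding abs_mult by (intro mult_mono abs_sin_le_one) auto
      then show ?thesis
        using r by (simp add: f_def abs_mult mult_left_le)
    qed
    have f_int: "integrable M (f m)" for m
      by (rule integrable_const_bound[OF AE_I2[OF f_le]]) (unfold f_def, rule meas, measurable)
    have sumf: "summable (\<lambda>m. norm (f m \<theta>))" for \<theta>
      by (rule summable_comparison_test'[OF summ[OF r], of 0]) (use f_le in simp)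
    have "(\<lambda>m. integral\<^sup>L M (f m)) sums (\<integral>\<theta>. (\<Sum>m. f m \<theta>) \<partial>M)"
    proof (rule sums_integral[OF f_int])
      show "AE \<theta> in M. summable (\<lambda>m. norm (f m \<theta>))" using sumf by simp
      have "summable (\<lambda>m. measure M (space M) * (\<bar>\<alpha> m\<bar> * r ^ m))"
        by (rule summable_mult[OF summ[OF r]])
      moreover have "norm (\<integral>\<theta>. norm (f m \<theta>) \<partial>M) \<le> measure M (space M) * (\<bar>\<alpha> m\<bar> * r ^ m)" for m
      proof -
        have "(\<integral>\<theta>. norm (f m \<theta>) \<partial>M) \<le> (\<integral>\<theta>. \<bar>\<alpha> m\<bar> * r ^ m \<partial>M)"
          by (intro integral_mono integrable_norm f_int f_le) simp
        then show ?thesis by simp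
      qed
      ultimately show "summable (\<lambda>m. \<integral>\<theta>. norm (f m \<theta>) \<partial>M)"
        by (rule summable_comparison_test')
    qed
    moreover have "(\<Sum>m. f m \<theta>) = u r \<theta> * sin (real n * \<theta>)" for \<theta>
    proof -
      have "summable (\<lambda>m. norm (\<alpha> m * r ^ m * sin (real m * \<theta>)))"
        by (rule summable_comparison_test'[OF summ[OF r], of 0])
          (use r in \<open>simp add: abs_mult mult_left_le\<close>)
      then have "(\<Sum>m. \<alpha> m * r ^ m * sin (real m * \<theta>) * sin (real n * \<theta>)) = u r \<theta> * sin (real n * \<theta>)"
        unfolding u_def by (rule suminf_mult2[OF summable_norm_cancel, symmetric])
      then show ?thesis by (simp add: f_def mult.assoc)
    qed
    moreover have "integral\<^sup>L M (f m) = (if m = n then pi / 2 * (\<alpha> n * r ^ n) else 0)" for m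
      using sin_orthogonal[OF n, of m] by (simp add: f_def M_def)
    ultimately have "(\<lambda>m. if m = n then pi / 2 * (\<alpha> n * r ^ n) else 0) sums (\<integral>\<theta>. u r \<theta> * sin (real n * \<theta>) \<partial>M)"
      by simp
    then show ?thesis using sums_single[of n "\<lambda>_. pi / 2 * (\<alpha> n * r ^ n)"] sums_unique2 by blast
  qed
  \<comment> \<open>Dominated convergence is applied along a sequence of radii increasing to 1.\<close>
  define \<rho> where "\<rho> = (\<lambda>k::nat. 1 - 1 / (real k + 2))"
  have \<rho>: "0 \<le> \<rho> k" "\<rho> k < 1" for k by (simp_all add: \<rho>_def field_simps)
  have \<rho>_lim: "\<rho> \<longlonglongrightarrow> 1" unfolding \<rho>_def by real_asymp
  then have \<rho>_left: "filterlim \<rho> (at_left 1) sequentially"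
    using \<rho>(2) less_imp_neq[OF \<rho>(2)] by (simp add: filterlim_at)
  have ae: "AE \<theta> in M. (\<lambda>k. u (\<rho> k) \<theta> * sin (real n * \<theta>)) \<longlonglongrightarrow> 0"
  proof -
    have "AE \<theta> in lborel. \<theta> \<noteq> 0" "AE \<theta> in lborel. \<theta> \<noteq> pi" by (rule AE_lborel_singleton)+
    with lim have "AE \<theta> in lborel. \<theta> \<in> {0..pi} \<longrightarrow> (\<lambda>k. u (\<rho> k) \<theta> * sin (real n * \<theta>)) \<longlonglongrightarrow> 0"
    proof eventually_elim
      case (elim \<theta>)
      show ?case
      proof
        assume "\<theta> \<in> {0..pi}"
        with elim have "((\<lambda>r. u r \<theta>) \<longlongrightarrow> 0) (at_left 1)" by (auto simp: u_def)
        from filterlim_compose[OF this \<rho>_left]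
        show "(\<lambda>k. u (\<rho> k) \<theta> * sin (real n * \<theta>)) \<longlonglongrightarrow> 0" by (rule tendsto_mult_left_zero)
      qed
    qed
    then show ?thesis unfolding M_def by (subst AE_restrict_space_iff) auto
  qed
  have "(\<lambda>k. integral\<^sup>L M (\<lambda>\<theta>. u (\<rho> k) \<theta> * sin (real n * \<theta>))) \<longlonglongrightarrow> integral\<^sup>L M (\<lambda>\<theta>. 0)"
  proof (rule integral_dominated_convergence[where w = "\<lambda>_. B"])
    show "(\<lambda>\<theta>. u (\<rho> k) \<theta> * sin (real n * \<theta>)) \<in> borel_measurable M" for k
      by (intro borel_measurable_times u_meas meas) measurable
    show "AE \<theta> in M. norm (u (\<rho> k) \<theta> * sin (real n * \<theta>)) \<le> B" for k
    proof (rule AE_I2)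
      fix \<theta>
      have "\<bar>u (\<rho> k) \<theta>\<bar> * \<bar>sin (real n * \<theta>)\<bar> \<le> \<bar>u (\<rho> k) \<theta>\<bar>" by (simp add: mult_left_le)
      also have "\<dots> \<le> B" using bd[OF \<rho>] by (simp add: u_def)
      finally show "norm (u (\<rho> k) \<theta> * sin (real n * \<theta>)) \<le> B" by (simp add: abs_mult)
    qed
  qed (use ae in simp_all)
  then have "(\<lambda>k. pi / 2 * (\<alpha> n * \<rho> k ^ n)) \<longlonglongrightarrow> 0"
    using coeff[OF \<rho>] by simp
  moreover have "(\<lambda>k. pi / 2 * (\<alpha> n * \<rho> k ^ n)) \<longlonglongrightarrow> pi / 2 * (\<alpha> n * 1 ^ n)"
    by (intro tendsto_intros \<rho>_lim)
  ultimately show ?thesis using LIMSEQ_unique by fastforce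
qed

section \<open>Almost every boundary point of a single slice\<close>

lemma DIM_quat: "DIM(quat) = 4"
  by (simp add: Basis_quat_def)

text \<open>
  The surface measure of a set is a multiple of the volume of the cone over it, so a null set on the
  sphere spans a null cone in the ball.
\<close>

lemma AE_sphere_measure_cone:
  assumes "AE u in sphere_measure. P u"
  shows "negligible {q \<in> \<bool> - {0}. \<not> P (sgn q)}"
proof -
  let ?M = "restrict_space lborel (\<bool> - {0} :: quat set)"
  have ball: "\<bool> - {0} \<in> sets (lborel :: quat measure)"
  proof -
    have "(\<bool> :: quat set) = ball 0 1" by (auto simp: quat_ball_def)
    then show ?thesis by (metis borel_open open_ball open_delete sets_lborel)
  qed
  from assms obtain N where N: "N \<in> sets sphere_measure" "emeasure sphere_measure N = 0"
    "{u \<in> space sphere_measure. \<not> P u} \<subseteq> N"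
    by (auto elim: AE_E)
  have "AE u in distr ?M (restrict_space borel (sphere 0 1)) sgn. P u"
  proof (rule AE_I)
    show "{u \<in> space (distr ?M (restrict_space borel (sphere 0 1)) sgn). \<not> P u} \<subseteq> N"
      using N(3) by (simp add: sphere_measure_def space_scale_measure)
    show "emeasure (distr ?M (restrict_space borel (sphere 0 1)) sgn) N = 0"
      using N(2) by (simp add: sphere_measure_def)
    show "N \<in> sets (distr ?M (restrict_space borel (sphere 0 1)) sgn)"
      using N(1) by (simp add: sphere_measure_def)
  qed
  from AE_distrD[OF measurable_sgn_sphere this]
  have "AE q in lborel. q \<in> \<bool> - {0} \<longrightarrow> P (sgn q)"
    using ball by (simp add: AE_restrict_space_iff)
  then have "{q. \<not> (q \<in> \<bool> - {0} \<longrightarrow> P (sgn q))} \<in> null_sets lebesgue"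
    using AE_iff_null_sets by (auto simp: AE_completion_iff eventually_ae_filter null_sets_completion_iff2)
  moreover have "{q. \<not> (q \<in> \<bool> - {0} \<longrightarrow> P (sgn q))} = {q \<in> \<bool> - {0}. \<not> P (sgn q)}" by auto
  ultimately show ?thesis by (simp add: negligible_iff_null_sets)
qed

text \<open>
  On the half space \<open>qk q > 0\<close> the chart \<open>\<Psi>\<close> records the norm of \<open>q\<close>, its angle \<open>\<theta>\<close> with the real
  axis and, in two projective coordinates, the unit \<open>I\<close> of its slice. It is differentiable, so it maps
  the null cone of bad points to a null set, and by Fubini almost every choice of the other three
  coordinates leaves only a null set of bad angles. A single such \<open>I\<close> is enough here, because the
  Lipschitz condition will carry boundary limits from one slice to all others.
\<close>

lemma AE_sphere_measure_slice:
  assumes "AE u in sphere_measure. P u"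
  obtains I where "I \<in> \<S>"
    "AE \<theta> in lborel. 0 < \<theta> \<and> \<theta> < pi \<longrightarrow> P (of_real (cos \<theta>) + of_real (sin \<theta>) * I)"
proof -
  define N where "N = {q \<in> \<bool> - {0}. \<not> P (sgn q)} \<inter> {q. qk q > 0}"
  have negN: "negligible N"
    unfolding N_def by (rule negligible_Int) (use AE_sphere_measure_cone[OF assms] in simp)
  define \<Psi> :: "quat \<Rightarrow> (real \<times> real \<times> real) \<times> real"
    where "\<Psi> = (\<lambda>q. ((norm q, qi q / qk q, qj q / qk q), arccos (q1 q / norm q)))"
  have "\<Psi> differentiable_on N"
    unfolding differentiable_on_def
  proof
    fix q assume "q \<in> N"
    then have k: "qk q > 0" by (simp add: N_def)
    then have n: "norm q > 0" by auto
    have lt: "\<bar>q1 q / norm q\<bar> < 1"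
    proof -
      have "(q1 q)\<^sup>2 < (norm q)\<^sup>2" unfolding norm_quat_sq using k
        by (smt (verit) zero_le_power2 zero_less_power)
      then have "\<bar>q1 q\<bar> < norm q" using power2_less_imp_less[of "\<bar>q1 q\<bar>" "norm q"] by simp
      then show ?thesis using n by (simp add: abs_divide)
    qed
    have sel: "(q1 has_derivative q1) (at q)" "(qi has_derivative qi) (at q)"
      "(qj has_derivative qj) (at q)" "(qk has_derivative qk) (at q)"
      using bounded_linear_quat_sel bounded_linear_imp_has_derivative by blast+
    then have sd: "q1 differentiable at q" "qi differentiable at q" "qj differentiable at q" "qk differentiable at q"
      unfolding differentiable_def by blast+
    have nd: "norm differentiable at q"
      using n by (intro differentiable_norm_at) auto
    have "(\<lambda>q. q1 q / norm q) differentiable at q"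
      using n sd nd by (intro differentiable_divide) auto
    then obtain D where D: "((\<lambda>q. q1 q / norm q) has_derivative D) (at q)"
      unfolding differentiable_def by blast
    have "(\<lambda>q. arccos (q1 q / norm q)) differentiable at q"
      unfolding differentiable_def using has_derivative_arccos[OF _ _ D] lt
      unfolding abs_less_iff by (metis minus_less_iff)
    then have "\<Psi> differentiable at q"
      unfolding \<Psi>_def using k sd nd
      by (intro differentiable_Pair differentiable_divide) auto
    then show "\<Psi> differentiable at q within N" by (rule differentiable_at_withinI)
  qed
  then have "negligible (\<Psi> ` N)"
    by (intro negligible_differentiable_image_negligible negN) (simp add: DIM_quat)
  then have "\<Psi> ` N \<in> null_sets (completion lborel)" by (simp add: negligible_iff_null_sets)
  then have "AE p in (lborel :: ((real \<times> real \<times> real) \<times> real) measure). p \<notin> \<Psi> ` N"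
    using AE_not_in AE_completion_iff by blast
  then have "AE p in (lborel \<Otimes>\<^sub>M lborel). p \<notin> \<Psi> ` N"
    unfolding lborel_prod .
  then have ae: "AE w in (lborel :: (real \<times> real \<times> real) measure). AE \<theta> in lborel. (w, \<theta>) \<notin> \<Psi> ` N"
    by (rule lborel_pair.AE_pair)
  have "\<exists>w. fst w \<in> {0<..<1} \<and> (AE \<theta> in lborel. (w, \<theta>) \<notin> \<Psi> ` N)"
  proof (rule ccontr)
    assume "\<not> ?thesis"
    then have "AE w in (lborel :: (real \<times> real \<times> real) measure). w \<notin> {0<..<1} \<times> UNIV"
      using ae by (auto elim!: eventually_mono)
    moreover have "{0<..<1} \<times> UNIV \<in> sets (lborel :: (real \<times> real \<times> real) measure)"
      unfolding sets_lborel by (intro borel_open open_Times) auto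
    ultimately have "{0<..<1} \<times> UNIV \<in> null_sets (lborel :: (real \<times> real \<times> real) measure)"
      by (simp only: AE_iff_null_sets)
    then have "negligible ({0<..<1} \<times> UNIV :: (real \<times> real \<times> real) set)"
      by (simp add: negligible_iff_null_sets null_sets_completionI)
    moreover have "open ({0<..<1} \<times> UNIV :: (real \<times> real \<times> real) set)"
      by (intro open_Times) auto
    moreover have "(1 / 2, 0, 0) \<in> ({0<..<1} \<times> UNIV :: (real \<times> real \<times> real) set)" by simp
    ultimately show False using open_not_negligible by blast
  qed
  then obtain r s t where r: "0 < r" "r < 1" and rst: "AE \<theta> in lborel. ((r, s, t), \<theta>) \<notin> \<Psi> ` N"
    by auto
  define c where "c = sqrt (1 + s\<^sup>2 + t\<^sup>2)"
  have c: "c > 0" "c\<^sup>2 = 1 + s\<^sup>2 + t\<^sup>2" unfolding c_def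
    by (simp_all add: add_pos_nonneg)
  define I where "I = Quat 0 (s / c) (t / c) (1 / c)"
  have "(norm I)\<^sup>2 = 1"
  proof -
    have "(norm I)\<^sup>2 = (1 + s\<^sup>2 + t\<^sup>2) / c\<^sup>2"
      unfolding norm_quat_sq by (simp add: I_def power_divide add_divide_distrib)
    then show ?thesis using c(1) by (simp flip: c(2))
  qed
  then have I: "I \<in> \<S>"
    by (simp add: imag_sphere_iff I_def) (metis norm_ge_zero power2_eq_1_iff neg_0_le_iff_le not_one_le_zero)
  have "P (of_real (cos \<theta>) + of_real (sin \<theta>) * I)"
    if nin: "((r, s, t), \<theta>) \<notin> \<Psi> ` N" and \<theta>: "0 < \<theta>" "\<theta> < pi" for \<theta>
  proof (rule ccontr)
    define v where "v = of_real (cos \<theta>) + of_real (sin \<theta>) * I"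
    assume not: "\<not> P (of_real (cos \<theta>) + of_real (sin \<theta>) * I)"
    have sel: "q1 v = cos \<theta>" "qi v = sin \<theta> * (s / c)" "qj v = sin \<theta> * (t / c)" "qk v = sin \<theta> * (1 / c)"
      by (simp_all add: v_def I_def of_real_def)
    have "v = slice_point I (Complex (cos \<theta>) (sin \<theta>))" by (simp add: v_def slice_point_def)
    then have nv: "norm v = 1" by (simp add: norm_slice_point[OF I] cmod_def)
    have "sin \<theta> > 0" using \<theta> by (rule sin_gt_zero)
    have "sgn (r *\<^sub>R v) = v" using r nv by (simp add: sgn_div_norm)
    then have "r *\<^sub>R v \<in> N"
      using not r nv c \<open>sin \<theta> > 0\<close> unfolding v_def[symmetric]
      by (auto simp: N_def quat_ball_def sel)
    moreover have "\<Psi> (r *\<^sub>R v) = ((r, s, t), \<theta>)"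
      using r nv c \<open>sin \<theta> > 0\<close> \<theta> by (simp add: \<Psi>_def sel arccos_cos)
    ultimately show False using nin by (metis imageI)
  qed
  with rst have "AE \<theta> in lborel. 0 < \<theta> \<and> \<theta> < pi \<longrightarrow> P (of_real (cos \<theta>) + of_real (sin \<theta>) * I)"
    by (auto elim!: eventually_mono)
  with I show ?thesis by (rule that)
qed

section \<open>Estimates for the distance\<close>

lemma metric_norm_nonneg: "0 \<le> metric_norm w d"
  by (simp add: metric_norm_def Let_def)

lemma curve_length_nonneg: "0 \<le> curve_length \<gamma>"
  unfolding curve_length_def
proof (cases "(\<lambda>t. metric_norm (\<gamma> t) (vector_derivative \<gamma> (at t))) integrable_on {0..1}")
  case True
  then show "0 \<le> integral {0..1} (\<lambda>t. metric_norm (\<gamma> t) (vector_derivative \<gamma> (at t)))"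
    by (rule integral_nonneg) (rule metric_norm_nonneg)
qed (simp add: not_integrable_integral)

lemma dist_g_le_curve_length:
  assumes "admissible_curve p q \<gamma>"
  shows "dist_g p q \<le> curve_length \<gamma>"
  unfolding dist_g_def
  by (rule cINF_lower) (use assms curve_length_nonneg in \<open>auto intro!: bdd_belowI2[where m = 0]\<close>)

lemma norm_one_minus_square:
  "(norm (1 - w\<^sup>2 :: quat))\<^sup>2 = (1 - (norm w)\<^sup>2)\<^sup>2 + 4 * ((norm w)\<^sup>2 - (q1 w)\<^sup>2)"
  unfolding norm_quat_sq by (simp add: power2_eq_square algebra_simps)

lemma q1_sq_le_norm_sq: "(q1 w)\<^sup>2 \<le> (norm w)\<^sup>2"
  by (simp add: norm_quat_sq)

lemma norm_sq_less_one: "w \<in> \<bool> \<Longrightarrow> (norm w)\<^sup>2 < 1"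
  using power_strict_mono[of "norm w" 1 2] by (simp add: quat_ball_def)

lemma norm_slice_part_sq:
  assumes "I \<in> \<S>"
  shows "(norm (slice_part I d))\<^sup>2 = (q1 d)\<^sup>2 + (d \<bullet> I)\<^sup>2"
proof -
  have "d \<bullet> 1 = q1 d" by (simp add: inner_quat_def)
  then show ?thesis
    unfolding power2_norm_eq_inner slice_part_def
    by (simp add: inner_add_left inner_add_right imag_unit_inner[OF assms] power2_eq_square)
qed

text \<open>
  The squared weights of the two parts of \<open>d\<close> differ by a multiple of \<open>y\<^sup>2\<close>, where \<open>y\<close> is the norm of
  the imaginary part of \<open>w\<close>. This factor absorbs the unit of the slice, which is undetermined on the
  real axis, and leaves an expression that is visibly continuous in \<open>w\<close> and \<open>d\<close> throughout the ball.
\<close>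

lemma metric_norm_formula:
  assumes w: "w \<in> \<bool>"
  shows "metric_norm w d = sqrt (((1 - (norm w)\<^sup>2)\<^sup>2 * (norm d)\<^sup>2
      + 4 * (((norm w)\<^sup>2 - (q1 w)\<^sup>2) * (q1 d)\<^sup>2 + (w \<bullet> d - q1 w * q1 d)\<^sup>2))
    / ((1 - (norm w)\<^sup>2)\<^sup>2 * ((1 - (norm w)\<^sup>2)\<^sup>2 + 4 * ((norm w)\<^sup>2 - (q1 w)\<^sup>2))))"
proof -
  define J where "J = slice_unit w"
  have J: "J \<in> \<S>" "w \<in> slice J" using slice_unit by (simp_all add: J_def)
  then obtain z where z: "w = slice_point J z" unfolding slice_eq_range by blast
  define x y where "x = Re z" and "y = Im z"
  have qJ: "q1 J = 0" using J by (simp add: imag_sphere_iff)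
  have x: "q1 w = x" using qJ by (simp add: z slice_point_def x_def of_real_def)
  have n: "(norm w)\<^sup>2 = x\<^sup>2 + y\<^sup>2" by (simp add: z norm_slice_point[OF J(1)] cmod_power2 x_def y_def)
  have wd: "w \<bullet> d - q1 w * q1 d = y * (d \<bullet> J)"
    unfolding x by (simp add: z slice_point_def of_real_def inner_add_left x_def y_def inner_commute)
      (simp add: inner_quat_def qJ algebra_simps)
  \<comment> \<open>\<open>A\<close> and \<open>B\<close> are the denominators of the slice part and of the orthogonal part; \<open>B - A = 4 y\<^sup>2\<close>.\<close>
  define A where "A = (1 - (norm w)\<^sup>2)\<^sup>2"
  have A: "A > 0" using norm_sq_less_one[OF w] by (simp add: A_def)
  define B where "B = A + 4 * y\<^sup>2"
  have B: "B > 0" using A by (simp add: B_def add_pos_nonneg)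
  have N: "(norm (1 - w\<^sup>2))\<^sup>2 = B" unfolding norm_one_minus_square A_def B_def by (simp add: x n)
  define P where "P = (norm (slice_part J d))\<^sup>2"
  have P: "P = (q1 d)\<^sup>2 + (d \<bullet> J)\<^sup>2" unfolding P_def by (rule norm_slice_part_sq[OF J(1)])
  have "(norm (d - slice_part J d))\<^sup>2 = (norm d)\<^sup>2 - P"
    using norm_slice_part[OF J(1), of d] by (simp add: P_def)
  then have "metric_norm w d = sqrt (P / A + ((norm d)\<^sup>2 - P) / B)"
    unfolding metric_norm_def J_def[symmetric] Let_def N A_def[symmetric] P_def[symmetric] by simp
  also have "P / A + ((norm d)\<^sup>2 - P) / B = (A * (norm d)\<^sup>2 + (B - A) * P) / (A * B)"
    using A B by (simp add: field_simps)
  also have "(B - A) * P = 4 * (y\<^sup>2 * (q1 d)\<^sup>2 + (w \<bullet> d - q1 w * q1 d)\<^sup>2)"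
    unfolding wd P B_def by (simp add: algebra_simps power_mult_distrib)
  finally show ?thesis
    unfolding A_def[symmetric] using N by (simp add: x n B_def)
qed

lemma continuous_on_metric_norm:
  fixes \<gamma> D :: "'a::topological_space \<Rightarrow> quat"
  assumes "continuous_on S \<gamma>" "continuous_on S D" "\<gamma> ` S \<subseteq> \<bool>"
  shows "continuous_on S (\<lambda>t. metric_norm (\<gamma> t) (D t))"
proof -
  have "(1 - (norm (\<gamma> t))\<^sup>2)\<^sup>2 * ((1 - (norm (\<gamma> t))\<^sup>2)\<^sup>2 + 4 * ((norm (\<gamma> t))\<^sup>2 - (q1 (\<gamma> t))\<^sup>2)) \<noteq> 0" if "t \<in> S" for t
  proof -
    have "(norm (\<gamma> t))\<^sup>2 < 1" using assms(3) that norm_sq_less_one by blast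
    then have "(1 - (norm (\<gamma> t))\<^sup>2)\<^sup>2 > 0" by simp
    moreover have "(1 - (norm (\<gamma> t))\<^sup>2)\<^sup>2 + 4 * ((norm (\<gamma> t))\<^sup>2 - (q1 (\<gamma> t))\<^sup>2) > 0"
      using calculation q1_sq_le_norm_sq[of "\<gamma> t"] by (simp add: add_pos_nonneg)
    ultimately show ?thesis by simp
  qed
  moreover have "continuous_on S (\<lambda>t. q1 (\<gamma> t))" "continuous_on S (\<lambda>t. q1 (D t))"
    using assms bounded_linear_quat_sel(1) by (blast intro: bounded_linear.continuous_on)+
  ultimately have "continuous_on S (\<lambda>t. sqrt (((1 - (norm (\<gamma> t))\<^sup>2)\<^sup>2 * (norm (D t))\<^sup>2
      + 4 * (((norm (\<gamma> t))\<^sup>2 - (q1 (\<gamma> t))\<^sup>2) * (q1 (D t))\<^sup>2 + (\<gamma> t \<bullet> D t - q1 (\<gamma> t) * q1 (D t))\<^sup>2))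
    / ((1 - (norm (\<gamma> t))\<^sup>2)\<^sup>2 * ((1 - (norm (\<gamma> t))\<^sup>2)\<^sup>2 + 4 * ((norm (\<gamma> t))\<^sup>2 - (q1 (\<gamma> t))\<^sup>2)))))"
    using assms(1,2) by (intro continuous_intros) auto
  then show ?thesis
    by (rule continuous_on_cong[THEN iffD1, rotated -1])
      (use assms(3) in \<open>auto simp: metric_norm_formula image_subset_iff\<close>)
qed

lemma quat_ball_eq_ball: "\<bool> = ball 0 1"
  by (auto simp: quat_ball_def)

text \<open>
  The infimum that defines the distance is therefore taken over a nonempty set.
\<close>

lemma admissible_linepath:
  assumes "p \<in> \<bool>" "q \<in> \<bool>"
  shows "admissible_curve p q (linepath p q)"
proof -
  have seg: "closed_segment p q \<subseteq> \<bool>"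
    using assms unfolding quat_ball_eq_ball by (simp add: closed_segment_subset)
  have "continuous_on {0..1} (\<lambda>t. metric_norm (linepath p q t) (q - p))"
    using seg by (intro continuous_on_metric_norm continuous_on_const continuous_on_linepath)
      (metis linepath_image_01)
  then have "(\<lambda>t. metric_norm (linepath p q t) (q - p)) integrable_on {0..1}"
    by (rule integrable_continuous_real)
  with seg show ?thesis by (simp add: admissible_curve_def valid_path_linepath)
qed

lemma dist_g_greatest:
  assumes "p \<in> \<bool>" "q \<in> \<bool>" "\<And>\<gamma>. admissible_curve p q \<gamma> \<Longrightarrow> c \<le> curve_length \<gamma>"
  shows "c \<le> dist_g p q"
  unfolding dist_g_def
  by (rule cINF_greatest) (use admissible_linepath[OF assms(1,2)] assms(3) in auto)

text \<open>
  As 1 and \<open>w\<close> both lie in the slice of \<open>w\<close>, these inner products only see the slice part of \<open>d\<close>, and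
  that part is weighted with \<open>1 / (1 - \<bar>w\<bar>\<^sup>2)\<close>.
\<close>

lemma metric_norm_ge_slice:
  assumes w: "w \<in> \<bool>"
  shows "\<bar>q1 d\<bar> \<le> (1 - (norm w)\<^sup>2) * metric_norm w d" "\<bar>w \<bullet> d\<bar> \<le> (1 - (norm w)\<^sup>2) * metric_norm w d"
proof -
  define J where "J = slice_unit w"
  have J: "J \<in> \<S>" "w \<in> slice J" using slice_unit by (simp_all add: J_def)
  then obtain z where z: "w = slice_point J z" unfolding slice_eq_range by blast
  define P where "P = slice_part J d"
  have pos: "1 - (norm w)\<^sup>2 > 0" using norm_sq_less_one[OF w] by simp
  have "sqrt ((norm P)\<^sup>2 / (1 - (norm w)\<^sup>2)\<^sup>2) \<le> metric_norm w d"
    unfolding metric_norm_def J_def[symmetric] Let_def P_def by simp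
  then have P: "norm P \<le> (1 - (norm w)\<^sup>2) * metric_norm w d"
    using pos by (simp add: real_sqrt_divide pos_divide_le_eq mult.commute)
  have "(q1 d)\<^sup>2 \<le> (norm P)\<^sup>2"
    by (simp add: P_def norm_slice_part_sq[OF J(1)])
  then have "\<bar>q1 d\<bar> \<le> norm P" using abs_le_square_iff[of "q1 d" "norm P"] by simp
  with P show "\<bar>q1 d\<bar> \<le> (1 - (norm w)\<^sup>2) * metric_norm w d" by linarith
  have "w \<bullet> d = w \<bullet> P"
    by (simp add: z P_def slice_point_def slice_part_def of_real_def inner_add_left inner_add_right
        imag_unit_inner[OF J(1)] inner_commute)
  also have "\<bar>\<dots>\<bar> \<le> norm w * norm P" by (rule Cauchy_Schwarz_ineq2)
  also have "\<dots> \<le> 1 * norm P" using w by (intro mult_right_mono) (simp_all add: quat_ball_def)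
  finally show "\<bar>w \<bullet> d\<bar> \<le> (1 - (norm w)\<^sup>2) * metric_norm w d" using P by simp
qed

text \<open>
  On the closed ball this vanishes exactly at the unit quaternions with real part \<open>a\<close>.
\<close>

definition boundary_gauge :: "real \<Rightarrow> quat \<Rightarrow> real" where
  "boundary_gauge a w = (q1 w - a)\<^sup>2 + (1 - (norm w)\<^sup>2)\<^sup>2"

lemma boundary_gauge_pos: "w \<in> \<bool> \<Longrightarrow> boundary_gauge a w > 0"
  using norm_sq_less_one[of w] by (simp add: boundary_gauge_def add_nonneg_pos)

lemma valid_path_D:
  assumes "valid_path \<gamma>"
  obtains S where "finite S" "continuous_on {0..1} \<gamma>"
    "\<And>t. t \<in> {0..1} - S \<Longrightarrow> (\<gamma> has_vector_derivative vector_derivative \<gamma> (at t)) (at t)"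
    "continuous_on ({0..1} - S) (\<lambda>t. vector_derivative \<gamma> (at t))"
proof -
  obtain S where S: "finite S" "continuous_on {0..1} \<gamma>" "\<gamma> C1_differentiable_on ({0..1} - S)"
    using assms by (auto simp: valid_path_def piecewise_C1_differentiable_on_def)
  show ?thesis
    by (rule that[OF S(1,2)])
      (use S(3) in \<open>auto simp: C1_differentiable_on_eq vector_derivative_works\<close>)
qed

text \<open>
  Along a curve, with \<open>X = \<bar>Re w - a\<bar>\<close>, \<open>s = 1 - \<bar>w\<bar>\<^sup>2\<close>, gauge \<open>E = X\<^sup>2 + s\<^sup>2\<close> and speed \<open>m\<close>, the
  derivative of \<open>E\<close> is at most \<open>(2 X s + 4 s\<^sup>2) m \<le> 5 E m\<close>. So the logarithm of the gauge
  changes by at most 5 times the length. In particular, if one of two points at bounded distance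
  approaches the zero set of the gauge, so does the other.
\<close>

lemma boundary_gauge_le_exp_dist:
  assumes p: "p \<in> \<bool>" and q: "q \<in> \<bool>"
  shows "boundary_gauge a q \<le> exp (5 * dist_g p q) * boundary_gauge a p"
proof -
  have "ln (boundary_gauge a q / boundary_gauge a p) / 5 \<le> curve_length \<gamma>"
    if adm: "admissible_curve p q \<gamma>" for \<gamma>
  proof -
    let ?D = "\<lambda>t. vector_derivative \<gamma> (at t)"
    let ?E = "\<lambda>t. boundary_gauge a (\<gamma> t)"
    from adm obtain S where S: "finite S" "continuous_on {0..1} \<gamma>"
        "\<And>t. t \<in> {0..1} - S \<Longrightarrow> (\<gamma> has_vector_derivative ?D t) (at t)"
      unfolding admissible_curve_def by (auto elim: valid_path_D)
    have ball: "\<gamma> t \<in> \<bool>" if "t \<in> {0..1}" for t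
      using adm that by (auto simp: admissible_curve_def path_image_def)
    define h where "h = (\<lambda>t. (2 * (q1 (\<gamma> t) - a) * q1 (?D t)
        + 2 * (1 - \<gamma> t \<bullet> \<gamma> t) * (- (2 * (\<gamma> t \<bullet> ?D t)))) / ?E t)"
    \<comment> \<open>The value 0 is chosen at break points and end points, where \<open>vector_derivative\<close> may be arbitrary.\<close>
    define h' where "h' = (\<lambda>t. if t \<in> {0<..<1} - S then h t else 0)"
    have Ecomp: "?E t = (q1 (\<gamma> t) - a)\<^sup>2 + (1 - \<gamma> t \<bullet> \<gamma> t)\<^sup>2" for t
      by (simp add: boundary_gauge_def power2_norm_eq_inner)
    have E0: "(q1 (\<gamma> t) - a)\<^sup>2 + (1 - \<gamma> t \<bullet> \<gamma> t)\<^sup>2 \<noteq> 0" if "t \<in> {0..1}" for t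
      using boundary_gauge_pos[OF ball[OF that], of a] unfolding Ecomp by (rule less_imp_neq[THEN not_sym])
    have "(h' has_integral (ln (?E 1) - ln (?E 0))) {0..1}"
    proof (rule fundamental_theorem_of_calculus_interior_strong[OF S(1)])
      show "continuous_on {0..1} (\<lambda>t. ln (?E t))"
        unfolding Ecomp using E0
        by (intro continuous_intros S bounded_linear.continuous_on[OF bounded_linear_quat_sel(1)]) blast
      fix t assume t: "t \<in> {0<..<1} - S"
      then have t': "t \<in> {0..1} - S" by auto
      have dq: "((\<lambda>t. q1 (\<gamma> t)) has_real_derivative q1 (?D t)) (at t)"
        using bounded_linear.has_vector_derivative[OF bounded_linear_quat_sel(1) S(3)[OF t']]
        by (simp add: has_real_derivative_iff_has_vector_derivative)
      have ds: "((\<lambda>t. \<gamma> t \<bullet> \<gamma> t) has_real_derivative 2 * (\<gamma> t \<bullet> ?D t)) (at t)"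
        using bounded_bilinear.has_vector_derivative[OF bounded_bilinear_inner S(3)[OF t'] S(3)[OF t']]
        by (simp add: has_real_derivative_iff_has_vector_derivative inner_commute)
      have "(?E has_real_derivative 2 * (q1 (\<gamma> t) - a) * q1 (?D t)
          + 2 * (1 - \<gamma> t \<bullet> \<gamma> t) * (- (2 * (\<gamma> t \<bullet> ?D t)))) (at t)"
        unfolding Ecomp by (auto intro!: derivative_eq_intros dq ds simp: algebra_simps)
      moreover have "?E t > 0" using t' by (intro boundary_gauge_pos ball) auto
      ultimately have "((\<lambda>t. ln (?E t)) has_real_derivative h t) (at t)"
        using DERIV_chain2[OF DERIV_ln_divide] unfolding h_def by fastforce
      then show "((\<lambda>t. ln (?E t)) has_vector_derivative h' t) (at t)"
        using t by (simp add: h'_def has_real_derivative_iff_has_vector_derivative)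
    qed simp
    moreover have "norm (h' t) \<le> 5 * metric_norm (\<gamma> t) (?D t)" if "t \<in> {0..1}" for t
    proof -
      define s m X E where "s = 1 - (norm (\<gamma> t))\<^sup>2" and "m = metric_norm (\<gamma> t) (?D t)"
        and "X = \<bar>q1 (\<gamma> t) - a\<bar>" and "E = ?E t"
      have s: "s > 0" using norm_sq_less_one[OF ball[OF that]] by (simp add: s_def)
      have m: "m \<ge> 0" by (simp add: m_def metric_norm_nonneg)
      have E: "E = X\<^sup>2 + s\<^sup>2" by (simp add: E_def X_def s_def boundary_gauge_def)
      have "\<bar>h t * E\<bar> = \<bar>2 * (q1 (\<gamma> t) - a) * q1 (?D t) + 2 * s * (- 2 * (\<gamma> t \<bullet> ?D t))\<bar>"
        using boundary_gauge_pos[OF ball[OF that], of a] by (simp add: h_def E_def s_def power2_norm_eq_inner)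
      also have "\<dots> \<le> 2 * X * \<bar>q1 (?D t)\<bar> + 4 * s * \<bar>\<gamma> t \<bullet> ?D t\<bar>"
      proof -
        have "\<bar>2 * (q1 (\<gamma> t) - a) * q1 (?D t)\<bar> = 2 * X * \<bar>q1 (?D t)\<bar>"
          unfolding abs_mult X_def by simp
        moreover have "\<bar>2 * s * (- 2 * (\<gamma> t \<bullet> ?D t))\<bar> = 4 * s * \<bar>\<gamma> t \<bullet> ?D t\<bar>"
          unfolding abs_mult using s by simp
        ultimately show ?thesis by linarith
      qed
      also have "\<dots> \<le> 2 * X * (s * m) + 4 * s * (s * m)"
        using metric_norm_ge_slice[OF ball[OF that], of "?D t"] s
        by (intro add_mono mult_left_mono) (simp_all add: s_def m_def X_def)
      also have "\<dots> = (2 * X * s + 4 * s\<^sup>2) * m" by (simp add: algebra_simps power2_eq_square)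
      also have "\<dots> \<le> (5 * E) * m"
      proof (rule mult_right_mono[OF _ m])
        have "0 \<le> (X - s)\<^sup>2 + 4 * X\<^sup>2" by simp
        then show "2 * X * s + 4 * s\<^sup>2 \<le> 5 * E" by (simp add: E power2_eq_square algebra_simps)
      qed
      finally have "\<bar>h t\<bar> * E \<le> 5 * m * E" using boundary_gauge_pos[OF ball[OF that], of a]
        by (simp add: E_def abs_mult algebra_simps)
      then have "\<bar>h t\<bar> \<le> 5 * m"
        using boundary_gauge_pos[OF ball[OF that], of a] by (simp add: E_def)
      then show ?thesis using m by (simp add: h'_def m_def)
    qed
    moreover have "(\<lambda>t. 5 * metric_norm (\<gamma> t) (?D t)) integrable_on {0..1}"
      using adm by (intro integrable_on_mult_right) (simp add: admissible_curve_def)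
    ultimately have "norm (integral {0..1} h') \<le> integral {0..1} (\<lambda>t. 5 * metric_norm (\<gamma> t) (?D t))"
      by (intro integral_norm_bound_integral) auto
    moreover have "integral {0..1} h' = ln (?E 1) - ln (?E 0)"
      using \<open>(h' has_integral _) _\<close> by (rule integral_unique)
    moreover have "\<gamma> 0 = p" "\<gamma> 1 = q"
      using adm by (simp_all add: admissible_curve_def pathstart_def pathfinish_def)
    ultimately show ?thesis
      using boundary_gauge_pos[OF p, of a] boundary_gauge_pos[OF q, of a]
      by (simp add: curve_length_def ln_div)
  qed
  from dist_g_greatest[OF p q this]
  have "ln (boundary_gauge a q / boundary_gauge a p) \<le> 5 * dist_g p q" by simp
  then have "boundary_gauge a q / boundary_gauge a p \<le> exp (5 * dist_g p q)"
    using boundary_gauge_pos[OF p, of a] boundary_gauge_pos[OF q, of a]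
    by (metis divide_pos_pos exp_le_cancel_iff exp_ln)
  then show ?thesis
    using boundary_gauge_pos[OF p, of a] by (simp add: pos_divide_le_eq)
qed

text \<open>
  Turning \<open>I\<close> towards \<open>J\<close> moves the point orthogonally to its slice, with the constant speed
  \<open>\<bar>y\<bar> * \<tau> / \<bar>1 - w\<^sup>2\<bar>\<close>. Since \<open>\<bar>1 - w\<^sup>2\<bar> \<ge> 2 * \<bar>y\<bar>\<close>, the bound does not deteriorate at the boundary
  of the ball.
\<close>

lemma dist_g_rotation_orthonormal:
  assumes IJ: "I \<in> \<S>" "J \<in> \<S>" "I \<bullet> J = 0" and xy: "x\<^sup>2 + y\<^sup>2 < 1" and \<tau>: "0 \<le> \<tau>"
  shows "dist_g (of_real x + of_real y * I) (of_real x + of_real y * (cos \<tau> *\<^sub>R I + sin \<tau> *\<^sub>R J)) \<le> \<tau> / 2"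
proof -
  define u v where "u = (\<lambda>t. cos (\<tau> * t) *\<^sub>R I + sin (\<tau> * t) *\<^sub>R J)"
    and "v = (\<lambda>t. - sin (\<tau> * t) *\<^sub>R I + cos (\<tau> * t) *\<^sub>R J)"
  define \<gamma> where "\<gamma> = (\<lambda>t. x *\<^sub>R 1 + y *\<^sub>R u t)"
  have II: "q1 I = 0" "q1 J = 0" "I \<bullet> I = 1" "J \<bullet> J = 1" "J \<bullet> I = 0"
    using IJ imag_unit_inner by (auto simp: imag_sphere_iff inner_commute)
  have unit: "(cos t *\<^sub>R I + sin t *\<^sub>R J) \<in> \<S>" "norm (- sin t *\<^sub>R I + cos t *\<^sub>R J) = 1" for t
    using sin_cos_squared_add[of t] sin_cos_squared_add2[of t]
    by (simp_all add: imag_sphere_iff II IJ norm_eq_1 inner_add_left inner_add_right inner_diff_left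
      inner_diff_right power2_eq_square)
  have uS: "u t \<in> \<S>" and vn: "norm (v t) = 1" for t
    using unit by (simp_all add: u_def v_def)
  have uv: "v t \<bullet> u t = 0" for t
    by (simp add: u_def v_def inner_add_left inner_add_right inner_diff_left inner_diff_right II IJ)
  have der: "(\<gamma> has_vector_derivative (y * \<tau>) *\<^sub>R v t) (at t)" for t
    unfolding \<gamma>_def u_def v_def
    by (auto intro!: derivative_eq_intros simp: algebra_simps)
  have vd: "vector_derivative \<gamma> (at t) = (y * \<tau>) *\<^sub>R v t" for t
    by (rule vector_derivative_at[OF der])
  have \<gamma>: "\<gamma> t = slice_point (u t) (Complex x y)" for t
    by (simp add: \<gamma>_def slice_point_def of_real_def)
  have norm\<gamma>: "(norm (\<gamma> t))\<^sup>2 = x\<^sup>2 + y\<^sup>2" and q1\<gamma>: "q1 (\<gamma> t) = x" for t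
    using uS[of t] unfolding \<gamma> norm_slice_point[OF uS]
    by (simp_all add: cmod_power2 slice_point_def of_real_def imag_sphere_iff)
  define N where "N = sqrt ((1 - (x\<^sup>2 + y\<^sup>2))\<^sup>2 + 4 * y\<^sup>2)"
  have N: "norm (1 - (\<gamma> t)\<^sup>2) = N" for t
    using norm_one_minus_square[of "\<gamma> t"] unfolding N_def norm\<gamma> q1\<gamma>
    by (metis add_diff_cancel_left' norm_ge_zero real_sqrt_unique)
  have N_ge: "2 * \<bar>y\<bar> \<le> N" "N > 0"
  proof -
    show "N > 0" using xy unfolding N_def by (simp add: add_pos_nonneg)
    show "2 * \<bar>y\<bar> \<le> N" unfolding N_def by (rule real_le_rsqrt) (simp add: power_mult_distrib)
  qed
  have mn: "metric_norm (\<gamma> t) (vector_derivative \<gamma> (at t)) = \<bar>y\<bar> * \<tau> / N" for t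
  proof -
    have "metric_norm (\<gamma> t) (0 + (y * \<tau>) *\<^sub>R v t) =
      sqrt ((norm (0::quat))\<^sup>2 / (1 - (norm (\<gamma> t))\<^sup>2)\<^sup>2 + (norm ((y * \<tau>) *\<^sub>R v t))\<^sup>2 / (norm (1 - (\<gamma> t)\<^sup>2))\<^sup>2)"
    proof (rule metric_norm_eq[OF uS[of t]])
      show "\<gamma> t \<in> slice (u t)" unfolding \<gamma> by (rule slice_point_in_slice)
      show "0 \<in> slice (u t)" unfolding slice_eq_span by (auto intro!: exI[of _ 0])
      have "v t \<bullet> 1 = 0" by (simp add: v_def inner_quat_def II)
      then show "\<forall>w\<in>slice (u t). orthogonal ((y * \<tau>) *\<^sub>R v t) w"
        by (auto simp: slice_eq_span orthogonal_def inner_add_right uv)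
    qed
    then show ?thesis
      using \<tau> N_ge by (simp add: vd N vn real_sqrt_divide abs_mult)
  qed
  have "admissible_curve (\<gamma> 0) (\<gamma> 1) \<gamma>"
    unfolding admissible_curve_def
  proof (intro conjI)
    have "\<gamma> C1_differentiable_on {0..1}"
      unfolding C1_differentiable_on_def
      by (intro exI[of _ "\<lambda>t. (y * \<tau>) *\<^sub>R v t"] conjI ballI der)
        (auto simp: v_def intro!: continuous_intros)
    then show "valid_path \<gamma>"
      by (simp add: valid_path_def C1_differentiable_imp_piecewise)
    show "path_image \<gamma> \<subseteq> \<bool>"
    proof -
      have "norm (\<gamma> t) < 1" for t
        using norm\<gamma>[of t] xy by (metis abs_square_less_1 abs_norm_cancel)
      then show ?thesis by (auto simp: path_image_def quat_ball_def)
    qed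
    show "(\<lambda>t. metric_norm (\<gamma> t) (vector_derivative \<gamma> (at t))) integrable_on {0..1}"
      unfolding mn by (rule integrable_continuous_real) simp
  qed (simp_all add: pathstart_def pathfinish_def)
  then have "dist_g (\<gamma> 0) (\<gamma> 1) \<le> curve_length \<gamma>" by (rule dist_g_le_curve_length)
  also have "curve_length \<gamma> = \<bar>y\<bar> * \<tau> / N" by (simp add: curve_length_def mn)
  also have "\<dots> \<le> \<tau> / 2"
    using N_ge mult_right_mono[OF N_ge(1) \<tau>] by (simp add: field_simps)
  finally show ?thesis by (simp add: \<gamma>_def u_def of_real_def)
qed

lemma imag_sphere_orthogonal_exists:
  assumes "I \<in> \<S>"
  obtains J where "J \<in> \<S>" "I \<bullet> J = 0"
proof (cases "qi I = 0 \<and> qj I = 0")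
  case True
  then show ?thesis using that[OF quat_i_unit] by (simp add: inner_quat_def)
next
  case False
  define n where "n = sqrt ((qi I)\<^sup>2 + (qj I)\<^sup>2)"
  have n: "n > 0" "n\<^sup>2 = (qi I)\<^sup>2 + (qj I)\<^sup>2" using False
    by (auto simp: n_def sum_power2_gt_zero_iff)
  define J where "J = Quat 0 (- qj I / n) (qi I / n) 0"
  have "(norm J)\<^sup>2 = ((qi I)\<^sup>2 + (qj I)\<^sup>2) / n\<^sup>2"
    unfolding norm_quat_sq by (simp add: J_def power_divide add_divide_distrib)
  then have "(norm J)\<^sup>2 = 1" using n(1) by (simp flip: n(2))
  then have "J \<in> \<S>"
    by (simp add: imag_sphere_iff J_def) (metis norm_ge_zero power2_eq_1_iff neg_0_le_iff_le not_one_le_zero)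
  moreover have "I \<bullet> J = 0" by (simp add: inner_quat_def J_def)
  ultimately show ?thesis by (rule that)
qed

text \<open>
  Two imaginary units lie on a common great circle, at an angle \<open>arccos (I \<bullet> I') \<le> pi\<close>.
\<close>

lemma dist_g_rotation:
  assumes I: "I \<in> \<S>" "I' \<in> \<S>" and z: "norm z < 1"
  shows "dist_g (slice_point I z) (slice_point I' z) \<le> pi / 2"
proof -
  define c where "c = I \<bullet> I'"
  have II: "I \<bullet> I = 1" "I' \<bullet> I' = 1" "q1 I = 0" "q1 I' = 0" "norm I = 1" "norm I' = 1"
    using I imag_unit_inner by (auto simp: imag_sphere_iff)
  have c: "\<bar>c\<bar> \<le> 1" using Cauchy_Schwarz_ineq2[of I I'] by (simp add: c_def II)
  define w where "w = I' - c *\<^sub>R I"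
  have w: "w \<bullet> w = 1 - c\<^sup>2"
    by (simp add: w_def inner_diff_left inner_diff_right II c_def inner_commute power2_eq_square)
  \<comment> \<open>If \<open>I\<close> and \<open>I'\<close> are equal or opposite, any orthogonal unit \<open>J\<close> will do.\<close>
  obtain J where J: "J \<in> \<S>" "I \<bullet> J = 0" "I' = c *\<^sub>R I + sqrt (1 - c\<^sup>2) *\<^sub>R J"
  proof (cases "w = 0")
    case True
    obtain J where "J \<in> \<S>" "I \<bullet> J = 0" using imag_sphere_orthogonal_exists[OF I(1)] .
    moreover have "I' = c *\<^sub>R I + sqrt (1 - c\<^sup>2) *\<^sub>R J" using True w by (simp add: w_def)
    ultimately show ?thesis by (rule that)
  next
    case False
    have nw: "norm w = sqrt (1 - c\<^sup>2)" by (simp add: norm_eq_sqrt_inner w)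
    have "w /\<^sub>R norm w \<in> \<S>" using False by (simp add: imag_sphere_iff) (simp add: w_def II)
    moreover have "I \<bullet> (w /\<^sub>R norm w) = 0" by (simp add: w_def inner_diff_right II c_def)
    moreover have "I' = c *\<^sub>R I + sqrt (1 - c\<^sup>2) *\<^sub>R (w /\<^sub>R norm w)"
      using False by (simp add: nw[symmetric]) (simp add: w_def)
    ultimately show ?thesis by (rule that)
  qed
  have "(Re z)\<^sup>2 + (Im z)\<^sup>2 < 1"
    using z power_strict_mono[of "cmod z" 1 2] by (simp flip: cmod_power2)
  from dist_g_rotation_orthonormal[OF I(1) J(1,2) this arccos_lbound[of c]]
  have "dist_g (slice_point I z) (slice_point I' z) \<le> arccos c / 2"
    using c J(3) by (simp add: slice_point_def cos_arccos_abs sin_arccos_abs abs_le_iff)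
  also have "\<dots> \<le> pi / 2" using arccos_ubound[of c] c by simp
  finally show ?thesis .
qed

section \<open>Lipschitz inner functions preserve slices\<close>

lemma slice_point_rcis:
  "r *\<^sub>R (of_real (cos \<theta>) + of_real (sin \<theta>) * I) = slice_point I (rcis r \<theta>)"
  by (simp add: slice_point_def of_real_def algebra_simps)

lemma eventually_at_left_one: "\<forall>\<^sub>F r in at_left (1::real). 0 < r \<and> r < 1"
  by (subst eventually_at_left[of 0]) (auto intro!: exI[of _ 0])

lemma dist_g_nonneg: "p \<in> \<bool> \<Longrightarrow> q \<in> \<bool> \<Longrightarrow> 0 \<le> dist_g p q"
  by (rule dist_g_greatest) (auto intro: curve_length_nonneg)

text \<open>
  For each \<open>r\<close> the points \<open>slice_point I (rcis r \<theta>)\<close> and \<open>slice_point I' (rcis r \<theta>)\<close> are at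
  distance at most \<open>pi / 2\<close>, so their images are at bounded distance. The gauge at \<open>a = Re l\<close> tends to
  0 along the first image, hence also along the second.
\<close>

lemma lipschitz_boundary_limit:
  assumes ball: "\<And>q. q \<in> \<bool> \<Longrightarrow> f q \<in> \<bool>"
    and Lip: "\<And>p q. p \<in> \<bool> \<Longrightarrow> q \<in> \<bool> \<Longrightarrow> dist_g (f p) (f q) \<le> K * dist_g p q"
    and I: "I \<in> \<S>" "I' \<in> \<S>"
    and l: "((\<lambda>r. f (slice_point I (rcis r \<theta>))) \<longlongrightarrow> l) (at_left 1)" "norm l = 1"
  shows "((\<lambda>r. q1 (f (slice_point I' (rcis r \<theta>)))) \<longlongrightarrow> q1 l) (at_left 1)"
    and "((\<lambda>r. (norm (f (slice_point I' (rcis r \<theta>))))\<^sup>2) \<longlongrightarrow> 1) (at_left 1)"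
proof -
  let ?p = "\<lambda>r. slice_point I (rcis r \<theta>)" and ?q = "\<lambda>r. slice_point I' (rcis r \<theta>)"
  let ?E = "boundary_gauge (q1 l)"
  have ev: "\<forall>\<^sub>F r in at_left (1::real). 0 < r \<and> r < 1"
    by (rule eventually_at_left_one)
  have le: "?E (f (?q r)) \<le> exp (5 * (\<bar>K\<bar> * (pi / 2))) * ?E (f (?p r))" if r: "0 < r" "r < 1" for r
  proof -
    have z: "norm (rcis r \<theta>) < 1" using r by simp
    have pq: "?p r \<in> \<bool>" "?q r \<in> \<bool>" using z I by (simp_all add: slice_point_in_ball)
    have "dist_g (f (?p r)) (f (?q r)) \<le> K * dist_g (?p r) (?q r)" by (rule Lip[OF pq])
    also have "\<dots> \<le> \<bar>K\<bar> * dist_g (?p r) (?q r)"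
      using dist_g_nonneg[OF pq] by (intro mult_right_mono) auto
    also have "\<dots> \<le> \<bar>K\<bar> * (pi / 2)"
      by (intro mult_left_mono dist_g_rotation I z) simp
    finally have "dist_g (f (?p r)) (f (?q r)) \<le> \<bar>K\<bar> * (pi / 2)" .
    then have "exp (5 * dist_g (f (?p r)) (f (?q r))) * ?E (f (?p r))
        \<le> exp (5 * (\<bar>K\<bar> * (pi / 2))) * ?E (f (?p r))"
      using boundary_gauge_pos[OF ball[OF pq(1)], of "q1 l"]
      by (intro mult_right_mono exp_le_cancel_iff[THEN iffD2] mult_left_mono) simp_all
    with boundary_gauge_le_exp_dist[OF ball[OF pq(1)] ball[OF pq(2)], of "q1 l"]
    show ?thesis by linarith
  qed
  have "((\<lambda>r. ?E (f (?p r))) \<longlongrightarrow> (q1 l - q1 l)\<^sup>2 + (1 - (norm l)\<^sup>2)\<^sup>2) (at_left 1)"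
    unfolding boundary_gauge_def
    by (intro tendsto_intros l bounded_linear.tendsto[OF bounded_linear_quat_sel(1) l(1)])
  then have lim: "((\<lambda>r. exp (5 * (\<bar>K\<bar> * (pi / 2))) * ?E (f (?p r))) \<longlongrightarrow> 0) (at_left 1)"
    using l(2) by (intro tendsto_mult_right_zero) simp
  have up: "\<forall>\<^sub>F r in at_left 1. ?E (f (?q r)) \<le> exp (5 * (\<bar>K\<bar> * (pi / 2))) * ?E (f (?p r))"
    using ev by eventually_elim (use le in blast)
  have lo: "\<forall>\<^sub>F r in at_left 1. 0 \<le> ?E (f (?q r))" by (simp add: boundary_gauge_def)
  have E0: "((\<lambda>r. ?E (f (?q r))) \<longlongrightarrow> 0) (at_left 1)"
    by (rule tendsto_sandwich[OF lo up tendsto_const lim])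
  have sq: "((\<lambda>r. g r) \<longlongrightarrow> 0) (at_left 1)" if "\<And>r. (g r)\<^sup>2 \<le> ?E (f (?q r))" for g :: "real \<Rightarrow> real"
  proof -
    have "((\<lambda>r. (g r)\<^sup>2) \<longlongrightarrow> 0) (at_left 1)"
      by (rule tendsto_sandwich[OF _ _ tendsto_const E0]) (use that in auto)
    then have "((\<lambda>r. sqrt ((g r)\<^sup>2)) \<longlongrightarrow> sqrt 0) (at_left 1)" by (rule tendsto_real_sqrt)
    then show ?thesis by (simp add: tendsto_rabs_zero_iff)
  qed
  have "((\<lambda>r. q1 (f (?q r)) - q1 l) \<longlongrightarrow> 0) (at_left 1)"
    by (rule sq) (simp add: boundary_gauge_def)
  then show "((\<lambda>r. q1 (f (?q r))) \<longlongrightarrow> q1 l) (at_left 1)" by (rule LIM_zero_cancel)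
  have "((\<lambda>r. 1 - (norm (f (?q r)))\<^sup>2) \<longlongrightarrow> 0) (at_left 1)"
    by (rule sq) (simp add: boundary_gauge_def)
  from tendsto_diff[OF tendsto_const this, of 1]
  show "((\<lambda>r. (norm (f (?q r)))\<^sup>2) \<longlongrightarrow> 1) (at_left 1)" by simp
qed

lemma sums_eq_first_term:
  fixes g :: "nat \<Rightarrow> 'a::real_normed_vector"
  assumes "g sums s" "\<And>n. n \<ge> 1 \<Longrightarrow> g n = 0"
  shows "s = g 0"
proof -
  have "g sums (\<Sum>n\<in>{0}. g n)" using assms(2) by (intro sums_finite) auto
  with assms(1) show ?thesis by (simp add: sums_iff)
qed

lemma stem_component_sums:
  fixes L :: "quat \<Rightarrow> real"
  assumes S: "\<And>q. q \<in> \<bool> \<Longrightarrow> (\<lambda>n. q ^ n * a n) sums f q" and L: "bounded_linear L" and z: "norm z < 1"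
  shows "(\<lambda>n. Re (z ^ n) * L (a n)) sums L (stem_re a z)" "(\<lambda>n. Im (z ^ n) * L (a n)) sums L (stem_im a z)"
  using bounded_linear.sums[OF L stem_sums(1)[OF S z]] bounded_linear.sums[OF L stem_sums(2)[OF S z]]
  by (simp_all add: linear_scale[OF bounded_linear.linear[OF L]])

text \<open>
  By the representation formula, \<open>2 * I * stem_im a z\<close> is the difference of the values of \<open>f\<close> at the
  points for \<open>I\<close> and \<open>- I\<close>.
\<close>

lemma stem_im_bounded:
  assumes S: "\<And>q. q \<in> \<bool> \<Longrightarrow> (\<lambda>n. q ^ n * a n) sums f q"
    and ball: "\<And>q. q \<in> \<bool> \<Longrightarrow> f q \<in> \<bool>" and z: "norm z < 1"
  shows "norm (stem_im a z) \<le> 1"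
proof -
  define i where "i = Quat 0 1 0 0"
  have i: "i \<in> \<S>" "- i \<in> \<S>" using quat_i_unit imag_sphere_uminus by (auto simp: i_def)
  have "2 *\<^sub>R (i * stem_im a z) = f (slice_point i z) - f (slice_point (- i) z)"
    using representation_formula[OF S z i(1)] representation_formula[OF S z i(2)]
    by (simp add: scaleR_2)
  then have "norm (2 *\<^sub>R (i * stem_im a z)) \<le> norm (f (slice_point i z)) + norm (f (slice_point (- i) z))"
    using norm_triangle_ineq4 by metis
  also have "\<dots> \<le> 1 + 1"
  proof -
    have "f (slice_point i z) \<in> \<bool>" "f (slice_point (- i) z) \<in> \<bool>"
      using i z by (auto intro!: ball simp: slice_point_in_ball)
    then show ?thesis by (simp add: quat_ball_def)
  qed
  finally show ?thesis using i by (simp add: norm_mult imag_sphere_iff)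
qed

text \<open>
  In polar coordinates \<open>Im (z ^ n) = r ^ n * sin (n * \<theta>)\<close>, so a real component of the stem function
  is a sine series whose coefficients are the components of the \<open>a n\<close>.
\<close>

lemma stem_im_boundary_zero:
  fixes L :: "quat \<Rightarrow> real"
  assumes S: "\<And>q. q \<in> \<bool> \<Longrightarrow> (\<lambda>n. q ^ n * a n) sums f q"
    and ball: "\<And>q. q \<in> \<bool> \<Longrightarrow> f q \<in> \<bool>"
    and L: "bounded_linear L" "\<And>q. \<bar>L q\<bar> \<le> norm q"
    and ae: "AE \<theta> in lborel. 0 < \<theta> \<and> \<theta> < pi \<longrightarrow> ((\<lambda>r. L (stem_im a (rcis r \<theta>))) \<longlongrightarrow> 0) (at_left 1)"
    and n: "n \<ge> 1"
  shows "L (a n) = 0"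
proof -
  have ser: "(\<Sum>n. L (a n) * r ^ n * sin (real n * \<theta>)) = L (stem_im a (rcis r \<theta>))"
    if "0 \<le> r" "r < 1" for r \<theta>
  proof -
    have "(\<lambda>n. Im (rcis r \<theta> ^ n) * L (a n)) sums L (stem_im a (rcis r \<theta>))"
      by (rule stem_component_sums(2)[OF S L(1)]) (use that in auto)
    then show ?thesis by (simp add: DeMoivre2 sums_iff mult_ac)
  qed
  have ev: "\<forall>\<^sub>F r in at_left (1::real). 0 < r \<and> r < 1"
    by (rule eventually_at_left_one)
  show ?thesis
  proof (rule sine_series_coeffs_vanish[OF _ _ _ n, of "\<lambda>n. L (a n)" 1])
    fix r :: real assume r: "0 \<le> r" "r < 1"
    show "summable (\<lambda>n. \<bar>L (a n)\<bar> * r ^ n)"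
      by (rule summable_comparison_test'[OF powser_norm_summable[OF S r], of 0])
        (use r L(2) in \<open>auto simp: abs_mult intro: mult_right_mono\<close>)
    fix \<theta>
    show "\<bar>\<Sum>n. L (a n) * r ^ n * sin (real n * \<theta>)\<bar> \<le> 1"
      unfolding ser[OF r] by (rule order_trans[OF L(2) stem_im_bounded[where f = f, OF S ball]]) (use r in auto)
  next
    show "AE \<theta> in lborel. 0 < \<theta> \<and> \<theta> < pi \<longrightarrow>
        ((\<lambda>r. \<Sum>n. L (a n) * r ^ n * sin (real n * \<theta>)) \<longlongrightarrow> 0) (at_left 1)"
      using ae
    proof (eventually_elim, intro impI)
      fix \<theta> assume "0 < \<theta> \<and> \<theta> < pi \<longrightarrow> ((\<lambda>r. L (stem_im a (rcis r \<theta>))) \<longlongrightarrow> 0) (at_left 1)"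
        "0 < \<theta> \<and> \<theta> < pi"
      then have "((\<lambda>r. L (stem_im a (rcis r \<theta>))) \<longlongrightarrow> 0) (at_left 1)" by blast
      then show "((\<lambda>r. \<Sum>n. L (a n) * r ^ n * sin (real n * \<theta>)) \<longlongrightarrow> 0) (at_left 1)"
        by (rule tendsto_cong[THEN iffD1, rotated]) (use ev ser in \<open>auto elim!: eventually_mono\<close>)
    qed
  qed
qed

lemma inner_sphere_eq_zero_imp_real:
  assumes "\<And>J. J \<in> \<S> \<Longrightarrow> h \<bullet> J = 0"
  shows "h = of_real (q1 h)"
  using assms[OF quat_i_unit] assms[OF quat_j_unit] assms[OF quat_k_unit]
  by (simp add: quat_eq_iff inner_quat_def of_real_def)

lemma real_coeffs_imp_slice_preserving:
  assumes S: "\<And>q. q \<in> \<bool> \<Longrightarrow> (\<lambda>n. q ^ n * a n) sums f q"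
    and real: "\<And>n J. J \<in> \<S> \<Longrightarrow> a n \<bullet> J = 0"
  shows "slice_preserving f"
  unfolding slice_preserving_def
proof (intro ballI subsetI)
  fix I p assume I: "I \<in> \<S>" and "p \<in> f ` (slice I \<inter> \<bool>)"
  then obtain z where p: "p = f (slice_point I z)" and "slice_point I z \<in> \<bool>"
    unfolding slice_eq_range by blast
  then have z: "norm z < 1" using I by (simp add: slice_point_in_ball)
  have "stem_re a z \<bullet> J = 0" "stem_im a z \<bullet> J = 0" if "J \<in> \<S>" for J
    using stem_component_sums[OF S bounded_linear_inner_left z, of J] real[OF that] sums_0 sums_unique2
    by fastforce+
  then obtain x y where xy: "stem_re a z = of_real x" "stem_im a z = of_real y"
    using inner_sphere_eq_zero_imp_real by metis
  have "p = of_real x + of_real y * I"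
    using representation_formula[OF S z I] unfolding p xy by (simp add: of_real_def)
  then show "p \<in> slice I" unfolding slice_def by blast
qed

text \<open>
  Write \<open>b\<close> and \<open>c\<close> for the stem functions. At a good angle the limits of \<open>Re (b + J c)\<close> and of
  \<open>\<bar>b + J c\<bar>\<^sup>2\<close> are the same for \<open>J\<close> and \<open>- J\<close>, and their differences are \<open>- 2 (c \<bullet> J)\<close> and
  \<open>4 (b \<bullet> J c)\<close>. The first limit makes all \<open>a n\<close> with \<open>n \<ge> 1\<close> real. The second one then makes
  \<open>a 0\<close> real, since otherwise \<open>c\<close> and with it the dependence of \<open>f\<close> on \<open>q\<close> would disappear.
\<close>

theorem lipschitz_inner_imp_slice_preserving:
  assumes f: "inner_function f"
    and Lip: "\<And>p q. p \<in> \<bool> \<Longrightarrow> q \<in> \<bool> \<Longrightarrow> dist_g (f p) (f q) \<le> K * dist_g p q"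
  shows "slice_preserving f"
proof -
  have ball: "\<And>q. q \<in> \<bool> \<Longrightarrow> f q \<in> \<bool>" using f by (auto simp: inner_function_def)
  obtain a where S: "\<And>q. q \<in> \<bool> \<Longrightarrow> (\<lambda>n. q ^ n * a n) sums f q"
    using slice_regular_power_series f unfolding inner_function_def by metis
  define good where "good = (\<lambda>I \<theta>. \<exists>l. ((\<lambda>r. f (slice_point I (rcis r \<theta>))) \<longlongrightarrow> l) (at_left 1) \<and> norm l = 1)"
  obtain I where I: "I \<in> \<S>" and ae: "AE \<theta> in lborel. 0 < \<theta> \<and> \<theta> < pi \<longrightarrow> good I \<theta>"
    using f AE_sphere_measure_slice[of "\<lambda>u. \<exists>l. ((\<lambda>r. f (r *\<^sub>R u)) \<longlongrightarrow> l) (at_left 1) \<and> norm l = 1"]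
    unfolding inner_function_def good_def slice_point_rcis by blast
  have ev: "\<forall>\<^sub>F r in at_left (1::real). 0 < r \<and> r < 1"
    by (rule eventually_at_left_one)
  have stem_limits: "((\<lambda>r. stem_im a (rcis r \<theta>) \<bullet> J) \<longlongrightarrow> 0) (at_left 1)"
      "((\<lambda>r. stem_re a (rcis r \<theta>) \<bullet> (J * stem_im a (rcis r \<theta>))) \<longlongrightarrow> 0) (at_left 1)"
    if \<theta>: "good I \<theta>" and J: "J \<in> \<S>" for \<theta> J
  proof -
    let ?b = "\<lambda>r. stem_re a (rcis r \<theta>)" and ?c = "\<lambda>r. stem_im a (rcis r \<theta>)"
    obtain l where l: "((\<lambda>r. f (slice_point I (rcis r \<theta>))) \<longlongrightarrow> l) (at_left 1)" "norm l = 1"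
      using \<theta> by (auto simp: good_def)
    note lim = lipschitz_boundary_limit[OF ball Lip I _ l]
    have J': "- J \<in> \<S>" using J by (rule imag_sphere_uminus)
    have rep: "f (slice_point J (rcis r \<theta>)) = ?b r + J * ?c r"
      "f (slice_point (- J) (rcis r \<theta>)) = ?b r - J * ?c r" if "0 < r" "r < 1" for r
      using that representation_formula[OF S _ J, of "rcis r \<theta>"]
        representation_formula[OF S _ J', of "rcis r \<theta>"] by simp_all
    have lim1: "((\<lambda>r. (q1 (f (slice_point (- J) (rcis r \<theta>))) - q1 (f (slice_point J (rcis r \<theta>)))) / 2)
        \<longlongrightarrow> (q1 l - q1 l) / 2) (at_left 1)"
      by (intro tendsto_intros lim J J') auto
    have eq1: "\<forall>\<^sub>F r in at_left 1. (q1 (f (slice_point (- J) (rcis r \<theta>))) - q1 (f (slice_point J (rcis r \<theta>)))) / 2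
        = ?c r \<bullet> J"
      using ev
    proof eventually_elim
      case (elim r)
      have "q1 (J * ?c r) = - (?c r \<bullet> J)"
        using J by (simp add: imag_sphere_iff inner_quat_def)
      then show ?case using elim by (simp add: rep del: quat_sel_mult)
    qed
    from Lim_transform_eventually[OF lim1 eq1]
    show "((\<lambda>r. ?c r \<bullet> J) \<longlongrightarrow> 0) (at_left 1)" by simp
    have lim2: "((\<lambda>r. ((norm (f (slice_point J (rcis r \<theta>))))\<^sup>2 - (norm (f (slice_point (- J) (rcis r \<theta>))))\<^sup>2) / 4)
        \<longlongrightarrow> (1 - 1) / 4) (at_left 1)"
      by (intro tendsto_intros lim J J') auto
    have eq2: "\<forall>\<^sub>F r in at_left 1. ((norm (f (slice_point J (rcis r \<theta>))))\<^sup>2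
        - (norm (f (slice_point (- J) (rcis r \<theta>))))\<^sup>2) / 4 = ?b r \<bullet> (J * ?c r)"
      using ev
    proof eventually_elim
      case (elim r)
      then show ?case
        by (simp add: rep power2_norm_eq_inner inner_add_left inner_add_right inner_diff_left
            inner_diff_right inner_commute)
    qed
    from Lim_transform_eventually[OF lim2 eq2]
    show "((\<lambda>r. ?b r \<bullet> (J * ?c r)) \<longlongrightarrow> 0) (at_left 1)" by simp
  qed
  have inner_le: "\<bar>h \<bullet> J\<bar> \<le> norm h" if "J \<in> \<S>" for h J
    using Cauchy_Schwarz_ineq2[of h J] that by (simp add: imag_sphere_iff)
  have higher: "a n \<bullet> J = 0" if n: "n \<ge> 1" and J: "J \<in> \<S>" for n J
  proof (rule stem_im_boundary_zero[OF S ball bounded_linear_inner_left inner_le[OF J] _ n])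
    show "AE \<theta> in lborel. 0 < \<theta> \<and> \<theta> < pi \<longrightarrow> ((\<lambda>r. stem_im a (rcis r \<theta>) \<bullet> J) \<longlongrightarrow> 0) (at_left 1)"
      using ae by eventually_elim (use stem_limits(1)[OF _ J] in blast)
  qed
  have stem_im_real: "stem_im a z = of_real (q1 (stem_im a z))" if z: "norm z < 1" for z
  proof (rule inner_sphere_eq_zero_imp_real)
    fix J assume J: "J \<in> \<S>"
    have "stem_im a z \<bullet> J = Im (z ^ 0) * (a 0 \<bullet> J)"
      by (rule sums_eq_first_term[OF stem_component_sums(2)[OF S bounded_linear_inner_left z]])
        (use higher J in auto)
    then show "stem_im a z \<bullet> J = 0" by simp
  qed
  \<comment> \<open>If \<open>a 0\<close> had a component along \<open>J\<close>, then \<open>f\<close> would be constant, with a value inside the ball.\<close>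
  have zeroth: "a 0 \<bullet> J = 0" if J: "J \<in> \<S>" for J
  proof (rule ccontr)
    assume nz: "a 0 \<bullet> J \<noteq> 0"
    have stem_re_J: "stem_re a z \<bullet> J = a 0 \<bullet> J" if z: "norm z < 1" for z
    proof -
      have "stem_re a z \<bullet> J = Re (z ^ 0) * (a 0 \<bullet> J)"
        by (rule sums_eq_first_term[OF stem_component_sums(1)[OF S bounded_linear_inner_left z]])
          (use higher J in auto)
      then show ?thesis by simp
    qed
    have q1_zero: "q1 (a n) = 0" if n: "n \<ge> 1" for n
    proof (rule stem_im_boundary_zero[OF S ball bounded_linear_quat_sel(1) abs_quat_sel_le_norm(1) _ n])
      show "AE \<theta> in lborel. 0 < \<theta> \<and> \<theta> < pi \<longrightarrow> ((\<lambda>r. q1 (stem_im a (rcis r \<theta>))) \<longlongrightarrow> 0) (at_left 1)"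
        using ae
      proof (eventually_elim, intro impI)
        fix \<theta> assume "0 < \<theta> \<and> \<theta> < pi \<longrightarrow> good I \<theta>" "0 < \<theta> \<and> \<theta> < pi"
        then have "good I \<theta>" by blast
        from tendsto_divide[OF stem_limits(2)[OF this J] tendsto_const nz]
        have "((\<lambda>r. stem_re a (rcis r \<theta>) \<bullet> (J * stem_im a (rcis r \<theta>)) / (a 0 \<bullet> J)) \<longlongrightarrow> 0) (at_left 1)"
          by simp
        moreover have "\<forall>\<^sub>F r in at_left 1. stem_re a (rcis r \<theta>) \<bullet> (J * stem_im a (rcis r \<theta>)) / (a 0 \<bullet> J)
            = q1 (stem_im a (rcis r \<theta>))"
          using ev
        proof eventually_elim
          case (elim r)
          then have z: "norm (rcis r \<theta>) < 1" by simp
          have "J * stem_im a (rcis r \<theta>) = q1 (stem_im a (rcis r \<theta>)) *\<^sub>R J"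
            by (subst stem_im_real[OF z]) (simp add: of_real_def)
          then show ?case using stem_re_J[OF z] nz by simp
        qed
        ultimately show "((\<lambda>r. q1 (stem_im a (rcis r \<theta>))) \<longlongrightarrow> 0) (at_left 1)"
          by (rule Lim_transform_eventually)
      qed
    qed
    have zero: "a n = 0" if "n \<ge> 1" for n
      using inner_sphere_eq_zero_imp_real[of "a n"] higher[OF that] q1_zero[OF that] by simp
    have const: "f q = a 0" if q: "q \<in> \<bool>" for q
      using sums_eq_first_term[OF S[OF q]] zero by simp
    have "norm (a 0) < 1" using ball[of 0] const[of 0] by (simp add: quat_ball_def)
    \<comment> \<open>The constant value is not of norm 1, so there would be no good angle at all.\<close>
    have "\<not> good I \<theta>" for \<theta>
    proof
      assume "good I \<theta>"
      then obtain l where l: "((\<lambda>r. f (slice_point I (rcis r \<theta>))) \<longlongrightarrow> l) (at_left 1)" "norm l = 1"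
        by (auto simp: good_def)
      have "\<forall>\<^sub>F r in at_left 1. f (slice_point I (rcis r \<theta>)) = a 0"
        using ev by eventually_elim (simp add: const slice_point_in_ball I)
      with l(1) have "((\<lambda>r::real. a 0) \<longlongrightarrow> l) (at_left 1)" by (rule Lim_transform_eventually)
      then have "l = a 0" by (simp add: tendsto_const_iff)
      with l(2) \<open>norm (a 0) < 1\<close> show False by simp
    qed
    with ae have "AE \<theta> in lborel. \<theta> \<notin> {0<..<pi}" by simp
    then have "{0<..<pi} \<in> null_sets lborel" by (subst (asm) AE_iff_null_sets[symmetric]) auto
    then show False using pi_gt_zero by (simp add: null_sets_def)
  qed
  show ?thesis
  proof (rule real_coeffs_imp_slice_preserving[OF S])
    show "a n \<bullet> J = 0" if "J \<in> \<S>" for n J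
      using that higher[of n J] zeroth[of J] by (cases n) auto
  qed
qed

section \<open>Slice preserving functions are contractions\<close>

text \<open>
  Moebius maps that move \<open>w\<close> and \<open>\<phi> w\<close> to 0 reduce this to the Schwarz lemma.
\<close>

lemma Schwarz_Pick:
  assumes hol: "\<phi> holomorphic_on ball 0 1" and lt: "\<And>z. norm z < 1 \<Longrightarrow> norm (\<phi> z) < 1"
    and z: "norm z < 1" and w: "norm w < 1"
  shows "norm (\<phi> z - \<phi> w) * norm (1 - cnj w * z) \<le> norm (z - w) * norm (1 - cnj (\<phi> w) * \<phi> z)"
proof -
  define g where "g = (\<lambda>\<zeta>. Moebius_function 0 (\<phi> w) (\<phi> (Moebius_function 0 (- w) \<zeta>)))"
  define \<zeta> where "\<zeta> = Moebius_function 0 w z"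
  have M: "norm (Moebius_function 0 (- w) u) < 1" if "norm u < 1" for u
    using Moebius_function_norm_lt_1[of "- w" u 0] w that by simp
  have "norm \<zeta> < 1" unfolding \<zeta>_def by (rule Moebius_function_norm_lt_1[OF w z])
  have nz: "1 - cnj v * u \<noteq> 0" if "norm v < 1" "norm u < 1" for u v :: complex
  proof
    assume "1 - cnj v * u = 0"
    then have "norm (cnj v * u) = 1" by (metis eq_iff_diff_eq_0 norm_one)
    then show False using mult_strict_mono[of "norm v" 1 "norm u" 1] that by (simp add: norm_mult)
  qed
  have "g holomorphic_on ball 0 1"
    unfolding g_def
  proof (rule holomorphic_on_compose_gen[unfolded o_def, OF _ Moebius_function_holomorphic[OF lt[OF w]]])
    show "(\<lambda>\<zeta>. \<phi> (Moebius_function 0 (- w) \<zeta>)) holomorphic_on ball 0 1"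
      by (rule holomorphic_on_compose_gen[unfolded o_def, OF Moebius_function_holomorphic hol])
        (use w M in auto)
    show "(\<lambda>\<zeta>. \<phi> (Moebius_function 0 (- w) \<zeta>)) ` ball 0 1 \<subseteq> ball 0 1" using M lt by auto
  qed
  moreover have "g 0 = 0" by (simp add: g_def Moebius_function_of_zero Moebius_function_eq_zero)
  moreover have "norm (g u) < 1" if "norm u < 1" for u
    unfolding g_def by (intro Moebius_function_norm_lt_1 lt w M that)
  ultimately have "norm (g \<zeta>) \<le> norm \<zeta>"
    using Schwarz_Lemma(1) \<open>norm \<zeta> < 1\<close> by blast
  moreover have "g \<zeta> = Moebius_function 0 (\<phi> w) (\<phi> z)"
    unfolding g_def \<zeta>_def using Moebius_function_compose[of "- w" w z] w z by simp
  ultimately have "norm (\<phi> z - \<phi> w) / norm (1 - cnj (\<phi> w) * \<phi> z) \<le> norm (z - w) / norm (1 - cnj w * z)"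
    by (simp add: \<zeta>_def Moebius_function_simple norm_divide)
  then show ?thesis
    using nz[OF w z] nz[OF lt[OF w] lt[OF z]] by (simp add: field_simps)
qed

text \<open>
  Divide the two-point inequality by \<open>\<bar>z - w\<bar>\<close> and let \<open>z\<close> tend to \<open>w\<close>.
\<close>

lemma Schwarz_Pick_deriv:
  assumes hol: "\<phi> holomorphic_on ball 0 1" and lt: "\<And>z. norm z < 1 \<Longrightarrow> norm (\<phi> z) < 1"
    and w: "norm w < 1"
  shows "norm (deriv \<phi> w) * (1 - (norm w)\<^sup>2) \<le> 1 - (norm (\<phi> w))\<^sup>2"
proof -
  have der: "(\<phi> has_field_derivative deriv \<phi> w) (at w)"
    using hol w by (intro holomorphic_derivI[of _ "ball 0 1"]) auto
  then have q: "((\<lambda>z. (\<phi> z - \<phi> w) / (z - w)) \<longlongrightarrow> deriv \<phi> w) (at w)"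
    by (simp add: has_field_derivative_iff)
  have cont: "(\<phi> \<longlongrightarrow> \<phi> w) (at w)"
    using der by (meson DERIV_isCont isCont_def)
  have self: "norm (1 - cnj u * u) = 1 - (norm u)\<^sup>2" if "norm u < 1" for u :: complex
  proof -
    have "1 - cnj u * u = of_real (1 - (norm u)\<^sup>2)"
      unfolding of_real_diff complex_norm_square by (simp add: mult.commute)
    moreover have "(norm u)\<^sup>2 \<le> 1" using that by (simp add: power_le_one)
    ultimately show ?thesis by (simp only: norm_of_real)
  qed
  have L: "((\<lambda>z. norm ((\<phi> z - \<phi> w) / (z - w)) * norm (1 - cnj w * z)) \<longlongrightarrow> norm (deriv \<phi> w) * norm (1 - cnj w * w)) (at w)"
    by (intro tendsto_intros q)
  have R: "((\<lambda>z. norm (1 - cnj (\<phi> w) * \<phi> z)) \<longlongrightarrow> norm (1 - cnj (\<phi> w) * \<phi> w)) (at w)"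
    by (intro tendsto_intros cont)
  have "\<forall>\<^sub>F z in at w. norm z < 1"
    using eventually_at_in_open'[of "ball 0 1" w] w by simp
  moreover have "\<forall>\<^sub>F z in at w. z \<noteq> w" by (simp add: eventually_at_filter)
  ultimately have "\<forall>\<^sub>F z in at w. norm ((\<phi> z - \<phi> w) / (z - w)) * norm (1 - cnj w * z) \<le> norm (1 - cnj (\<phi> w) * \<phi> z)"
  proof eventually_elim
    case (elim z)
    then have "norm (z - w) > 0" by simp
    with Schwarz_Pick[OF hol lt elim(1) w] show ?case by (simp add: norm_divide field_simps)
  qed
  from tendsto_le[OF _ R L this]
  show ?thesis by (simp add: self w lt)
qed

text \<open>
  A real point lies in the slice of any unit \<open>I\<close> orthogonal to \<open>J\<close>, so its image has no component
  along \<open>J\<close>. Hence the real power series with coefficients \<open>a n \<bullet> J\<close> vanishes on \<open>(-1, 1)\<close>.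
\<close>

lemma slice_preserving_imp_real_coeffs:
  assumes S: "\<And>q. q \<in> \<bool> \<Longrightarrow> (\<lambda>n. q ^ n * a n) sums f q" and sp: "slice_preserving f"
    and J: "J \<in> \<S>"
  shows "a n \<bullet> J = 0"
proof -
  obtain I where I: "I \<in> \<S>" "J \<bullet> I = 0" using imag_sphere_orthogonal_exists[OF J] .
  have ser: "(\<lambda>n. (a n \<bullet> J) * (x - 0) ^ n) sums 0" if x: "norm (x - 0) < 1" for x :: real
  proof -
    have b: "(of_real x :: quat) \<in> \<bool>" using x by (simp add: quat_ball_def)
    have "of_real x \<in> slice I"
      using slice_point_in_slice[of I "of_real x"] by simp
    then have "f (of_real x) \<in> slice I" using b sp I unfolding slice_preserving_def by blast
    then have "f (of_real x) \<bullet> J = 0"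
      using I(2) by (auto simp: slice_eq_span inner_add_left imag_unit_inner[OF J] inner_commute[of I J])
    moreover have "(\<lambda>n. (of_real x ^ n * a n) \<bullet> J) sums (f (of_real x) \<bullet> J)"
      by (rule bounded_linear.sums[OF bounded_linear_inner_left S[OF b]])
    moreover have "(of_real x ^ n * a n) \<bullet> J = (a n \<bullet> J) * x ^ n" for n
      unfolding of_real_power[symmetric] of_real_def by simp
    ultimately show ?thesis by simp
  qed
  show ?thesis
  proof (cases "n = 0")
    case True
    then show ?thesis using sums_eq_first_term[OF ser[of 0]] by simp
  next
    case False
    show ?thesis
    proof (rule ccontr)
      assume "a n \<bullet> J \<noteq> 0"
      from powser_0_nonzero[of 1 0 "\<lambda>n. a n \<bullet> J" "\<lambda>_. 0", OF zero_less_one ser refl this] False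
      obtain s where "0 < s" "\<And>z::real. z \<in> cball 0 s - {0} \<Longrightarrow> (0::real) \<noteq> 0" by auto
      from this(2)[of s] this(1) show False by simp
    qed
  qed
qed

text \<open>
  The coefficients are real, so the same series can be summed in the complex plane, and
  \<open>slice_point I\<close> carries the one sum to the other.
\<close>

lemma slice_preserving_complex_restriction:
  assumes f: "slice_regular f" "f ` \<bool> \<subseteq> \<bool>" and sp: "slice_preserving f"
  obtains \<alpha> :: "nat \<Rightarrow> real" and \<phi> where
    "\<And>q. q \<in> \<bool> \<Longrightarrow> (\<lambda>n. \<alpha> n *\<^sub>R q ^ n) sums f q"
    "\<phi> holomorphic_on ball 0 1"
    "\<And>z. norm z < 1 \<Longrightarrow> norm (\<phi> z) < 1"
    "\<And>z. norm z < 1 \<Longrightarrow> \<phi> (cnj z) = cnj (\<phi> z)"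
    "\<And>I z. I \<in> \<S> \<Longrightarrow> norm z < 1 \<Longrightarrow> f (slice_point I z) = slice_point I (\<phi> z)"
proof -
  obtain a where S: "\<And>q. q \<in> \<bool> \<Longrightarrow> (\<lambda>n. q ^ n * a n) sums f q"
    using slice_regular_power_series f(1) by metis
  define \<alpha> where "\<alpha> = (\<lambda>n. q1 (a n))"
  have a: "a n = of_real (\<alpha> n)" for n
    unfolding \<alpha>_def by (rule inner_sphere_eq_zero_imp_real) (rule slice_preserving_imp_real_coeffs[OF S sp])
  have S': "(\<lambda>n. \<alpha> n *\<^sub>R q ^ n) sums f q" if "q \<in> \<bool>" for q
    using S[OF that] by (simp add: a of_real_def)
  define \<phi> where "\<phi> = (\<lambda>z. \<Sum>n. of_real (\<alpha> n) * z ^ n :: complex)"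
  have \<phi>: "(\<lambda>n. of_real (\<alpha> n) * z ^ n) sums \<phi> z" if z: "norm z < 1" for z
  proof -
    have "summable (\<lambda>n. norm (of_real (\<alpha> n) * z ^ n))"
      using powser_norm_summable[OF S norm_ge_zero z] by (simp add: a norm_mult norm_power)
    then show ?thesis unfolding \<phi>_def by (intro summable_sums summable_norm_cancel[OF \<open>summable _\<close>])
  qed
  have f_slice: "f (slice_point I z) = slice_point I (\<phi> z)" if I: "I \<in> \<S>" and z: "norm z < 1" for I z
  proof -
    have "slice_point I (of_real (\<alpha> n) * z ^ n) = \<alpha> n *\<^sub>R slice_point I z ^ n" for n
      using slice_point_scaleR[of I "\<alpha> n" "z ^ n"] by (simp add: scaleR_conv_of_real slice_point_power[OF I])
    then have "(\<lambda>n. \<alpha> n *\<^sub>R slice_point I z ^ n) sums slice_point I (\<phi> z)"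
      using bounded_linear.sums[OF bounded_linear_slice_point[OF I] \<phi>[OF z]] by simp
    moreover have "slice_point I z \<in> \<bool>" using I z by (simp add: slice_point_in_ball)
    ultimately show ?thesis using S' sums_unique2 by blast
  qed
  show ?thesis
  proof (rule that[OF S' _ _ _ f_slice])
    show "\<phi> holomorphic_on ball 0 1"
      by (rule power_series_holomorphic[where a = "\<lambda>n. of_real (\<alpha> n)"]) (use \<phi> in simp)
    fix z :: complex assume z: "norm z < 1"
    have "slice_point (Quat 0 1 0 0) z \<in> \<bool>" using z by (simp add: slice_point_in_ball quat_i_unit)
    then have "slice_point (Quat 0 1 0 0) (\<phi> z) \<in> \<bool>"
      using f(2) f_slice[OF quat_i_unit z] by (metis image_subset_iff)
    then show "norm (\<phi> z) < 1" by (simp add: slice_point_in_ball quat_i_unit)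
    have "(\<lambda>n. of_real (\<alpha> n) * cnj z ^ n) sums cnj (\<phi> z)"
      using \<phi>[OF z] sums_cnj[of "\<lambda>n. of_real (\<alpha> n) * z ^ n" "\<phi> z"] by simp
    then show "\<phi> (cnj z) = cnj (\<phi> z)"
      using \<phi>[of "cnj z"] z sums_unique2 by fastforce
  qed
qed

text \<open>
  The derivative of \<open>q ^ n\<close> in the direction \<open>d\<close>. As \<open>q\<close> and \<open>d\<close> need not commute, it is the sum of
  all \<open>q ^ i * d * q ^ (n - 1 - i)\<close>, which the recursion builds up by the product rule.
\<close>

primrec power_deriv :: "nat \<Rightarrow> quat \<Rightarrow> quat \<Rightarrow> quat" where
  "power_deriv 0 q d = 0"
| "power_deriv (Suc n) q d = d * q ^ n + q * power_deriv n q d"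

lemma has_derivative_quat_power:
  "((\<lambda>q. q ^ n) has_derivative power_deriv n q) (at q within S)" for q :: quat
proof (induction n)
  case 0
  then show ?case by (simp add: has_derivative_const)
next
  case (Suc n)
  have "((\<lambda>q. q * q ^ n) has_derivative (\<lambda>h. q * power_deriv n q h + h * q ^ n)) (at q within S)"
    by (rule has_derivative_mult[OF has_derivative_ident Suc])
  then show ?case by (simp add: add.commute)
qed

lemma norm_power_deriv: "norm (power_deriv n q d) \<le> real n * norm q ^ (n - 1) * norm d"
proof (induction n)
  case (Suc n)
  have "norm (power_deriv (Suc n) q d) \<le> norm d * norm q ^ n + norm q * norm (power_deriv n q d)"
    by (simp, rule order_trans[OF norm_triangle_ineq]) (simp add: norm_mult norm_power)
  also have "\<dots> \<le> norm d * norm q ^ n + norm q * (real n * norm q ^ (n - 1) * norm d)"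
    by (intro add_left_mono mult_left_mono Suc) simp
  also have "\<dots> = real (Suc n) * norm q ^ (Suc n - 1) * norm d"
    by (cases n) (simp_all add: algebra_simps)
  finally show ?case .
qed simp

lemma continuous_power_deriv: "continuous_on S (\<lambda>p. power_deriv n (fst p) (snd p))"
  by (induction n) (auto intro!: continuous_intros)

definition series_deriv :: "(nat \<Rightarrow> real) \<Rightarrow> quat \<Rightarrow> quat \<Rightarrow> quat" where
  "series_deriv \<alpha> q d = (\<Sum>n. \<alpha> n *\<^sub>R power_deriv n q d)"

context
  fixes \<alpha> :: "nat \<Rightarrow> real" and f :: "quat \<Rightarrow> quat"
  assumes S: "\<And>q. q \<in> \<bool> \<Longrightarrow> (\<lambda>n. \<alpha> n *\<^sub>R q ^ n) sums f q"
begin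

text \<open>
  Up to an index shift this is the formal derivative of the real power series with coefficients
  \<open>\<bar>\<alpha> n\<bar>\<close>. It dominates the series of derivatives uniformly on the ball of radius \<open>r\<close>.
\<close>

lemma series_deriv_majorant:
  assumes r: "0 \<le> r" "r < 1"
  shows "summable (\<lambda>n. \<bar>\<alpha> n\<bar> * (real n * r ^ (n - 1)))"
proof -
  have *: "(\<lambda>n. q ^ n * of_real (\<alpha> n)) sums f q" if "q \<in> \<bool>" for q
    using S[OF that] by (simp add: of_real_def)
  have "summable (\<lambda>n. \<bar>\<alpha> n\<bar> * x ^ n)" if x: "norm x < 1" for x :: real
    by (rule summable_comparison_test'[OF powser_norm_summable[OF * norm_ge_zero x], of 0])
      (simp_all add: abs_mult power_abs)
  from termdiff_converges[of r 1 "\<lambda>n. \<bar>\<alpha> n\<bar>", OF _ this]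
  have "summable (\<lambda>n. real (Suc n) * \<bar>\<alpha> (Suc n)\<bar> * r ^ n)"
    using r by (simp add: diffs_def)
  then have "summable (\<lambda>n. \<bar>\<alpha> (Suc n)\<bar> * (real (Suc n) * r ^ (Suc n - 1)))"
    by (simp add: mult_ac)
  then show ?thesis by (subst (asm) summable_Suc_iff)
qed

lemma series_deriv_term_bound:
  assumes "norm q \<le> r"
  shows "norm (\<alpha> n *\<^sub>R power_deriv n q d) \<le> \<bar>\<alpha> n\<bar> * (real n * r ^ (n - 1)) * norm d"
proof -
  have "norm (\<alpha> n *\<^sub>R power_deriv n q d) \<le> \<bar>\<alpha> n\<bar> * (real n * norm q ^ (n - 1) * norm d)"
    unfolding norm_scaleR by (rule mult_left_mono[OF norm_power_deriv abs_ge_zero])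
  also have "\<dots> \<le> \<bar>\<alpha> n\<bar> * (real n * r ^ (n - 1) * norm d)"
    using assms by (intro mult_left_mono mult_right_mono power_mono) auto
  finally show ?thesis by (simp add: mult_ac)
qed

lemma has_derivative_series_deriv:
  assumes q: "q \<in> \<bool>"
  shows "(f has_derivative series_deriv \<alpha> q) (at q)"
proof -
  define r where "r = (1 + norm q) / 2"
  have r: "norm q < r" "r < 1" "0 \<le> r" using q by (auto simp: r_def quat_ball_def add_nonneg_pos)
  define M where "M = (\<lambda>n. \<bar>\<alpha> n\<bar> * (real n * r ^ (n - 1)))"
  have M: "summable M" unfolding M_def by (rule series_deriv_majorant[OF r(3,2)])
  have bound: "norm (\<alpha> n *\<^sub>R power_deriv n x h) \<le> M n * norm h" if "x \<in> ball 0 r" for n x h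
    unfolding M_def by (rule series_deriv_term_bound) (use that in auto)
  have "\<exists>g. \<forall>x\<in>ball 0 r. (\<lambda>n. \<alpha> n *\<^sub>R x ^ n) sums g x \<and>
      (g has_derivative series_deriv \<alpha> x) (at x within ball 0 r)"
  proof (rule has_derivative_series)
    show "((\<lambda>x. \<alpha> n *\<^sub>R x ^ n) has_derivative (\<lambda>h. \<alpha> n *\<^sub>R power_deriv n x h)) (at x within ball 0 r)" for n x
      by (rule has_derivative_scaleR_right[OF has_derivative_quat_power])
    show "\<forall>\<^sub>F n in sequentially. \<forall>x\<in>ball 0 r. \<forall>h.
        norm ((\<Sum>i<n. \<alpha> i *\<^sub>R power_deriv i x h) - series_deriv \<alpha> x h) \<le> e * norm h" if "e > 0" for e
    proof -
      obtain N where N: "\<And>n. n \<ge> N \<Longrightarrow> norm (\<Sum>i. M (i + n)) < e"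
        using suminf_exist_split[OF \<open>e > 0\<close> M] by blast
      have "norm ((\<Sum>i<n. \<alpha> i *\<^sub>R power_deriv i x h) - series_deriv \<alpha> x h) \<le> e * norm h"
        if n: "n \<ge> N" and x: "x \<in> ball 0 r" for n x h
      proof -
        have Mh: "summable (\<lambda>i. M i * norm h)" by (rule summable_mult2[OF M])
        have su: "summable (\<lambda>i. norm (\<alpha> i *\<^sub>R power_deriv i x h))"
          by (rule summable_comparison_test'[OF Mh, of 0]) (use bound[OF x] in simp)
        have sM: "summable (\<lambda>i. M (i + n))" using M by (subst summable_iff_shift)
        have "series_deriv \<alpha> x h - (\<Sum>i<n. \<alpha> i *\<^sub>R power_deriv i x h)
            = (\<Sum>i. \<alpha> (i + n) *\<^sub>R power_deriv (i + n) x h)"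
          unfolding series_deriv_def
          using suminf_minus_initial_segment[OF summable_norm_cancel[OF su], of n] by simp
        also have "norm \<dots> \<le> (\<Sum>i. M (i + n) * norm h)"
          by (rule norm_suminf_le[OF bound[OF x] summable_mult2[OF sM]])
        also have "\<dots> = (\<Sum>i. M (i + n)) * norm h" by (rule suminf_mult2[OF sM, symmetric])
        also have "\<dots> \<le> e * norm h"
          using N[OF n] by (intro mult_right_mono) auto
        finally show ?thesis by (simp add: norm_minus_commute)
      qed
      then show ?thesis unfolding eventually_sequentially by blast
    qed
    show "q \<in> ball 0 r" "(\<lambda>n. \<alpha> n *\<^sub>R q ^ n) sums f q" using r S[OF q] by auto
  qed simp
  then obtain g where g: "\<And>x. x \<in> ball 0 r \<Longrightarrow> (\<lambda>n. \<alpha> n *\<^sub>R x ^ n) sums g x"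
    "\<And>x. x \<in> ball 0 r \<Longrightarrow> (g has_derivative series_deriv \<alpha> x) (at x within ball 0 r)" by blast
  have eq: "g x = f x" if "x \<in> ball 0 r" for x
  proof -
    have "x \<in> \<bool>" using that r by (simp add: quat_ball_def)
    then show ?thesis using g(1)[OF that] S sums_unique2 by blast
  qed
  have q': "q \<in> ball 0 r" using r by simp
  then have "(g has_derivative series_deriv \<alpha> q) (at q)"
    using g(2) at_within_open[OF q' open_ball] by metis
  then show ?thesis
    by (rule has_derivative_transform_within_open[OF _ open_ball q']) (rule eq)
qed

text \<open>
  Joint continuity in base point and direction is what makes the image of a piecewise continuously
  differentiable curve again such a curve.
\<close>

lemma continuous_on_series_deriv:
  "continuous_on (\<bool> \<times> UNIV) (\<lambda>p. series_deriv \<alpha> (fst p) (snd p))"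
proof -
  have "isCont (\<lambda>p. series_deriv \<alpha> (fst p) (snd p)) (q, d)" if q: "q \<in> \<bool>" for q d
  proof -
    define r where "r = (1 + norm q) / 2"
    have r: "norm q < r" "r < 1" "0 \<le> r" using q by (auto simp: r_def quat_ball_def add_nonneg_pos)
    define A where "A = ball (0::quat) r \<times> ball (0::quat) (norm d + 1)"
    have "uniform_limit A (\<lambda>n p. \<Sum>i<n. \<alpha> i *\<^sub>R power_deriv i (fst p) (snd p))
        (\<lambda>p. series_deriv \<alpha> (fst p) (snd p)) sequentially"
      unfolding series_deriv_def
    proof (rule Weierstrass_m_test)
      fix n p assume p: "p \<in> A"
      have "norm (\<alpha> n *\<^sub>R power_deriv n (fst p) (snd p)) \<le> \<bar>\<alpha> n\<bar> * (real n * r ^ (n - 1)) * norm (snd p)"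
        by (rule series_deriv_term_bound) (use p in \<open>auto simp: A_def\<close>)
      also have "\<dots> \<le> \<bar>\<alpha> n\<bar> * (real n * r ^ (n - 1)) * (norm d + 1)"
        using p r by (intro mult_left_mono) (auto simp: A_def)
      finally show "norm (\<alpha> n *\<^sub>R power_deriv n (fst p) (snd p)) \<le> \<bar>\<alpha> n\<bar> * (real n * r ^ (n - 1)) * (norm d + 1)" .
    qed (rule summable_mult2[OF series_deriv_majorant[OF r(3,2)]])
    then have "continuous_on A (\<lambda>p. series_deriv \<alpha> (fst p) (snd p))"
      by (rule uniform_limit_theorem[rotated])
        (auto intro!: always_eventually continuous_intros continuous_power_deriv)
    moreover have "open A" "(q, d) \<in> A" using r by (auto simp: A_def intro: open_Times)
    ultimately show ?thesis by (simp add: continuous_on_eq_continuous_at)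
  qed
  then show ?thesis by (auto intro!: continuous_at_imp_continuous_on)
qed

end

text \<open>
  At \<open>q = slice_point I z\<close>, the differential \<open>D\<close> acts on the slice as multiplication by \<open>deriv \<phi> z\<close>.
  A direction orthogonal to the slice only turns \<open>I\<close>, at a rate inversely proportional to \<open>Im z\<close>, and
  the image \<open>slice_point I (\<phi> z)\<close> is turned at the same rate; so \<open>D\<close> multiplies this direction by
  \<open>k = Im (\<phi> z) / Im z\<close>. Both parts of the metric thus shrink separately. The second one does because
  \<open>2 \<bar>Im z\<bar> / \<bar>1 - z\<^sup>2\<bar>\<close> is the pseudo-hyperbolic distance of \<open>z\<close> from its conjugate, and \<open>\<phi>\<close>
  commutes with conjugation.
\<close>

lemma metric_norm_contraction:
  assumes hol: "\<phi> holomorphic_on ball 0 1"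
    and lt: "\<And>z. norm z < 1 \<Longrightarrow> norm (\<phi> z) < 1"
    and cnj: "\<And>z. norm z < 1 \<Longrightarrow> \<phi> (cnj z) = cnj (\<phi> z)"
    and f: "\<And>I z. I \<in> \<S> \<Longrightarrow> norm z < 1 \<Longrightarrow> f (slice_point I z) = slice_point I (\<phi> z)"
    and D: "(f has_derivative D) (at q)" and q: "q \<in> \<bool>"
  shows "metric_norm (f q) (D d) \<le> metric_norm q d"
proof -
  have linD: "linear D" using D has_derivative_linear by blast
  obtain I z \<zeta> d2 where I: "I \<in> \<S>" and qz: "q = slice_point I z" and d: "d = slice_point I \<zeta> + d2"
    and d2: "d2 \<bullet> 1 = 0" "d2 \<bullet> I = 0" and d2_real: "Im z = 0 \<longrightarrow> d2 = 0"
  proof -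
    obtain I z where I: "I \<in> \<S>" and qz: "q = slice_point I z" by (rule quat_in_slice)
    \<comment> \<open>A real \<open>q\<close> lies in every slice; the one that contains \<open>d\<close> leaves no orthogonal part.\<close>
    show thesis
    proof (cases "Im z = 0")
      case True
      then have z: "z = of_real (Re z)" by (simp add: complex_eq_iff)
      obtain K \<zeta> where K: "K \<in> \<S>" "d = slice_point K \<zeta>" by (rule quat_in_slice)
      have "slice_point I z = slice_point K z" by (subst (1 2) z) simp
      then show thesis using that[of K z \<zeta> 0] K qz by simp
    next
      case False
      define d1 where "d1 = slice_point I (Complex (d \<bullet> 1) (d \<bullet> I))"
      show thesis
        using that[of I z "Complex (d \<bullet> 1) (d \<bullet> I)" "d - d1"] I qz False
        by (simp add: d1_def slice_point_def of_real_def inner_diff_left inner_add_left imag_unit_inner)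
    qed
  qed
  have z: "norm z < 1" using q qz I by (simp add: slice_point_in_ball)
  define w where "w = \<phi> z"
  have w: "norm w < 1" using lt z by (simp add: w_def)
  have fq: "f q = slice_point I w" using f[OF I z] by (simp add: qz w_def)
  have D_slice: "D (slice_point I \<zeta>) = slice_point I (deriv \<phi> z * \<zeta>)"
  proof -
    have lin: "bounded_linear (slice_point I)" by (rule bounded_linear_slice_point[OF I])
    have "(\<phi> has_derivative (*) (deriv \<phi> z)) (at z)"
      using holomorphic_derivI[OF hol open_ball, of z] z by (simp add: has_field_derivative_def)
    then have "((\<lambda>u. slice_point I (\<phi> u)) has_derivative (\<lambda>u. slice_point I (deriv \<phi> z * u))) (at z)"
      by (rule bounded_linear.has_derivative[OF lin])
    moreover have "((\<lambda>u. f (slice_point I u)) has_derivative (\<lambda>u. D (slice_point I u))) (at z)"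
      using has_derivative_compose[OF bounded_linear_imp_has_derivative[OF lin] D[unfolded qz]] by simp
    then have "((\<lambda>u. slice_point I (\<phi> u)) has_derivative (\<lambda>u. D (slice_point I u))) (at z)"
      by (rule has_derivative_transform_within_open[OF _ open_ball[of 0 1]]) (use z f[OF I] in auto)
    ultimately have "(\<lambda>u. D (slice_point I u)) = (\<lambda>u. slice_point I (deriv \<phi> z * u))"
      by (rule has_derivative_unique[rotated])
    then show ?thesis by (rule fun_cong)
  qed
  have D_orth: "Im z *\<^sub>R D d2 = Im w *\<^sub>R d2"
  proof (cases "d2 = 0")
    case True
    then show ?thesis using linear_0[OF linD] by simp
  next
    case False
    define J where "J = d2 /\<^sub>R norm d2"
    have J: "J \<in> \<S>" "I \<bullet> J = 0" "d2 = norm d2 *\<^sub>R J"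
      using False d2 by (simp_all add: J_def imag_sphere_iff inner_commute) (simp add: inner_quat_def)
    have unit: "cos t *\<^sub>R I + sin t *\<^sub>R J \<in> \<S>" for t
      using I J imag_unit_inner[OF I] imag_unit_inner[OF J(1)] sin_cos_squared_add2[of t]
      by (simp add: imag_sphere_iff norm_eq_1 inner_add_left inner_add_right inner_commute[of J I]
          power2_eq_square)
    define c where "c = (\<lambda>v t. slice_point (cos t *\<^sub>R I + sin t *\<^sub>R J) v)"
    have c': "(c v has_vector_derivative Im v *\<^sub>R J) (at 0)" for v
      unfolding c_def slice_point_def of_real_def
      by (auto intro!: derivative_eq_intros)
    have "c z 0 = q" by (simp add: c_def qz)
    have "f (c z t) = c w t" for t
      unfolding c_def w_def by (rule f[OF unit z])
    then have "((\<lambda>t. f (c z t)) has_derivative (\<lambda>t. t *\<^sub>R (Im w *\<^sub>R J))) (at 0)"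
      using c'[of w] by (simp add: has_vector_derivative_def)
    moreover have "((\<lambda>t. f (c z t)) has_derivative (\<lambda>t. D (t *\<^sub>R (Im z *\<^sub>R J)))) (at 0)"
      using has_derivative_compose[OF c'[of z, unfolded has_vector_derivative_def], of f D] D
      by (simp add: \<open>c z 0 = q\<close>)
    ultimately have "D (1 *\<^sub>R (Im z *\<^sub>R J)) = 1 *\<^sub>R (Im w *\<^sub>R J)"
      by (metis has_derivative_unique)
    then have "Im z *\<^sub>R D J = Im w *\<^sub>R J" by (simp add: linear_scale[OF linD])
    then have "norm d2 *\<^sub>R (Im z *\<^sub>R D J) = norm d2 *\<^sub>R (Im w *\<^sub>R J)" by simp
    then have "Im z *\<^sub>R D (norm d2 *\<^sub>R J) = Im w *\<^sub>R (norm d2 *\<^sub>R J)"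
      by (simp add: linear_scale[OF linD] mult.commute)
    then show ?thesis using J(3) by simp
  qed
  \<comment> \<open>If \<open>Im z = 0\<close>, then \<open>d2 = 0\<close> and any real number may serve as \<open>k\<close>.\<close>
  define k where "k = (if Im z = 0 then 0 else Im w / Im z)"
  have Dd2: "D d2 = k *\<^sub>R d2"
  proof (cases "Im z = 0")
    case True
    then show ?thesis using d2_real linear_0[OF linD] by simp
  next
    case False
    have "Im z *\<^sub>R D d2 = Im z *\<^sub>R (k *\<^sub>R d2)" using D_orth False by (simp add: k_def)
    then show ?thesis using False by (simp only: scaleR_cancel_left) simp
  qed
  have norm_sq: "norm (1 - (slice_point I v)\<^sup>2) = norm (1 - v\<^sup>2)" for v
  proof -
    have "1 - (slice_point I v)\<^sup>2 = slice_point I (1 - v\<^sup>2)"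
      by (simp add: slice_point_power[OF I, symmetric]) (simp add: slice_point_def algebra_simps)
    then show ?thesis by (simp add: norm_slice_point[OF I])
  qed
  have mn: "metric_norm (slice_point I v) (slice_point I \<eta> + t *\<^sub>R d2)
      = sqrt ((norm \<eta> / (1 - (norm v)\<^sup>2))\<^sup>2 + (\<bar>t\<bar> / norm (1 - v\<^sup>2))\<^sup>2 * (norm d2)\<^sup>2)" for v \<eta> t
  proof -
    have "\<forall>u\<in>slice I. orthogonal (t *\<^sub>R d2) u"
      using d2 by (auto simp: slice_eq_span orthogonal_def inner_add_right)
    then show ?thesis
      using metric_norm_eq[OF I slice_point_in_slice slice_point_in_slice, of "t *\<^sub>R d2" v \<eta>]
      by (simp add: norm_slice_point[OF I] norm_sq power_divide power_mult_distrib)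
  qed
  have pos: "1 - (norm z)\<^sup>2 > 0" "1 - (norm w)\<^sup>2 > 0"
    using z w by (simp_all add: abs_square_less_1)
  have pos2: "norm (1 - v\<^sup>2) > 0" if "norm v < 1" for v :: complex
  proof -
    have "(norm v)\<^sup>2 < 1" using that by (simp add: abs_square_less_1)
    then have "v\<^sup>2 \<noteq> 1" by (metis norm_one norm_power less_irrefl)
    then show ?thesis by simp
  qed
  have tangential: "norm (deriv \<phi> z * \<zeta>) / (1 - (norm w)\<^sup>2) \<le> norm \<zeta> / (1 - (norm z)\<^sup>2)"
    using mult_right_mono[OF Schwarz_Pick_deriv[OF hol lt z] norm_ge_zero[of \<zeta>]] pos
    by (simp add: w_def norm_mult field_simps)
  have orthogonal: "\<bar>k\<bar> / norm (1 - w\<^sup>2) \<le> 1 / norm (1 - z\<^sup>2)"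
  proof (cases "Im z = 0")
    case False
    have "norm (2 * Im w * \<i>) * norm (1 - z\<^sup>2) \<le> norm (2 * Im z * \<i>) * norm (1 - w\<^sup>2)"
      using Schwarz_Pick[OF hol lt z, of "cnj z"] z
      by (simp add: cnj w_def[symmetric] complex_diff_cnj power2_eq_square)
    then have "\<bar>Im w\<bar> * norm (1 - z\<^sup>2) \<le> \<bar>Im z\<bar> * norm (1 - w\<^sup>2)" by (simp add: norm_mult)
    then show ?thesis using False pos2[OF z] pos2[OF w] by (simp add: k_def field_simps abs_divide)
  qed (simp add: k_def)
  have "D d = slice_point I (deriv \<phi> z * \<zeta>) + k *\<^sub>R d2"
    by (simp add: d linear_add[OF linD] D_slice Dd2)
  then have "metric_norm (f q) (D d)
      = sqrt ((norm (deriv \<phi> z * \<zeta>) / (1 - (norm w)\<^sup>2))\<^sup>2 + (\<bar>k\<bar> / norm (1 - w\<^sup>2))\<^sup>2 * (norm d2)\<^sup>2)"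
    by (simp only: fq mn)
  also have "\<dots> \<le> sqrt ((norm \<zeta> / (1 - (norm z)\<^sup>2))\<^sup>2 + (1 / norm (1 - z\<^sup>2))\<^sup>2 * (norm d2)\<^sup>2)"
    using tangential orthogonal pos pos2[OF w]
    by (intro real_sqrt_le_mono add_mono mult_right_mono power_mono) auto
  also have "\<dots> = metric_norm q d"
    using mn[of z \<zeta> 1] by (simp add: qz d)
  finally show ?thesis .
qed

text \<open>
  The image under \<open>f\<close> of an admissible curve from \<open>p\<close> to \<open>q\<close> is again admissible, and its
  speed is no larger at any smooth point. Its speed is integrable because it is continuous off the break points
  and dominated by the speed of the original curve.
\<close>

theorem slice_preserving_contraction:
  assumes f: "slice_regular f" and ball: "\<And>q. q \<in> \<bool> \<Longrightarrow> f q \<in> \<bool>" and sp: "slice_preserving f"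
    and p: "p \<in> \<bool>" and q: "q \<in> \<bool>"
  shows "dist_g (f p) (f q) \<le> dist_g p q"
proof (rule dist_g_greatest[OF p q])
  have img: "f ` \<bool> \<subseteq> \<bool>" using ball by blast
  obtain \<alpha> \<phi> where S: "\<And>q. q \<in> \<bool> \<Longrightarrow> (\<lambda>n. \<alpha> n *\<^sub>R q ^ n) sums f q"
    and \<phi>: "\<phi> holomorphic_on ball 0 1" "\<And>z. norm z < 1 \<Longrightarrow> norm (\<phi> z) < 1"
    "\<And>z. norm z < 1 \<Longrightarrow> \<phi> (cnj z) = cnj (\<phi> z)"
    "\<And>I z. I \<in> \<S> \<Longrightarrow> norm z < 1 \<Longrightarrow> f (slice_point I z) = slice_point I (\<phi> z)"
    using slice_preserving_complex_restriction[OF f img sp] by blast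
  fix \<gamma> assume adm: "admissible_curve p q \<gamma>"
  let ?D = "\<lambda>t. vector_derivative \<gamma> (at t)"
  let ?s = "\<lambda>t. metric_norm (\<gamma> t) (?D t)"
  from adm obtain F where F: "finite F" "continuous_on {0..1} \<gamma>"
      "\<And>t. t \<in> {0..1} - F \<Longrightarrow> (\<gamma> has_vector_derivative ?D t) (at t)"
      "continuous_on ({0..1} - F) ?D"
    unfolding admissible_curve_def by (auto elim: valid_path_D)
  have \<gamma>_ball: "\<gamma> t \<in> \<bool>" if "t \<in> {0..1}" for t
    using adm that by (auto simp: admissible_curve_def path_image_def)
  define T where "T = {0..1} - F"
  have der: "((f \<circ> \<gamma>) has_vector_derivative series_deriv \<alpha> (\<gamma> t) (?D t)) (at t)" if t: "t \<in> T" for t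
  proof -
    have Df: "(f has_derivative series_deriv \<alpha> (\<gamma> t)) (at (\<gamma> t))"
      using t by (intro has_derivative_series_deriv S \<gamma>_ball) (auto simp: T_def)
    have "(\<gamma> has_derivative (\<lambda>h. h *\<^sub>R ?D t)) (at t)"
      using F(3) t by (simp add: T_def has_vector_derivative_def)
    from has_derivative_compose[OF this Df]
    show ?thesis
      unfolding has_vector_derivative_def o_def
      by (simp add: linear_scale[OF has_derivative_linear[OF Df]])
  qed
  have vd: "vector_derivative (f \<circ> \<gamma>) (at t) = series_deriv \<alpha> (\<gamma> t) (?D t)" if "t \<in> T" for t
    by (rule vector_derivative_at[OF der[OF that]])
  have cont_\<gamma>: "continuous_on T \<gamma>" using F(2) by (rule continuous_on_subset) (auto simp: T_def)
  have cont_D: "continuous_on T (\<lambda>t. series_deriv \<alpha> (\<gamma> t) (?D t))"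
  proof -
    have "continuous_on T (\<lambda>t. (\<gamma> t, ?D t))"
      using cont_\<gamma> F(4) by (auto intro: continuous_on_Pair simp: T_def)
    moreover have "(\<lambda>t. (\<gamma> t, ?D t)) ` T \<subseteq> \<bool> \<times> UNIV" using \<gamma>_ball by (auto simp: T_def)
    ultimately show ?thesis
      using continuous_on_compose2[OF continuous_on_series_deriv[OF S]] by fastforce
  qed
  have cont_f: "continuous_on \<bool> f"
    using has_derivative_continuous[OF has_derivative_series_deriv[OF S]]
    by (auto intro!: continuous_at_imp_continuous_on)
  let ?s' = "\<lambda>t. metric_norm ((f \<circ> \<gamma>) t) (vector_derivative (f \<circ> \<gamma>) (at t))"
  have le: "?s' t \<le> ?s t" if t: "t \<in> T" for t
  proof -
    have b: "\<gamma> t \<in> \<bool>" using t \<gamma>_ball by (auto simp: T_def)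
    show ?thesis
      using metric_norm_contraction[OF \<phi> has_derivative_series_deriv[OF S b] b] vd[OF t] by simp
  qed
  \<comment> \<open>The finitely many break points do not affect integrals.\<close>
  have spike: "g integrable_on {0..1} \<longleftrightarrow> g integrable_on T" "integral {0..1} g = integral T g" for g :: "real \<Rightarrow> real"
  proof -
    have neg: "negligible {x \<in> {0..1} - T. g x \<noteq> 0}" "negligible {x \<in> T - {0..1}. g x \<noteq> 0}"
      by (rule negligible_subset[OF negligible_finite[OF F(1)]]; auto simp: T_def)+
    show "g integrable_on {0..1} \<longleftrightarrow> g integrable_on T"
      using neg by (blast intro: integrable_spike_set)
    show "integral {0..1} g = integral T g" by (rule integral_spike_set[OF neg])
  qed
  have int_s: "?s integrable_on T" using adm spike(1) by (auto simp: admissible_curve_def)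
  have int_s': "?s' integrable_on T"
  proof (rule measurable_bounded_by_integrable_imp_integrable[OF _ int_s])
    have "continuous_on T (\<lambda>t. metric_norm ((f \<circ> \<gamma>) t) (series_deriv \<alpha> (\<gamma> t) (?D t)))"
    proof (rule continuous_on_metric_norm[OF _ cont_D])
      show "continuous_on T (f \<circ> \<gamma>)"
        by (rule continuous_on_compose[OF cont_\<gamma>], rule continuous_on_subset[OF cont_f])
          (use \<gamma>_ball in \<open>auto simp: T_def\<close>)
      show "(f \<circ> \<gamma>) ` T \<subseteq> \<bool>" using \<gamma>_ball ball by (auto simp: T_def)
    qed
    then have "continuous_on T ?s'" by (simp add: vd cong: continuous_on_cong)
    moreover show T: "T \<in> sets lebesgue"
      unfolding T_def using F(1) by (intro sets.Diff) (auto simp: negligible_imp_sets negligible_finite)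
    ultimately show "?s' \<in> borel_measurable (lebesgue_on T)"
      by (rule continuous_imp_measurable_on_sets_lebesgue)
    show "norm (?s' t) \<le> ?s t" if "t \<in> T" for t
      using le[OF that] metric_norm_nonneg by simp
  qed
  have "admissible_curve (f p) (f q) (f \<circ> \<gamma>)"
    unfolding admissible_curve_def
  proof (intro conjI)
    have "continuous_on {0..1} (f \<circ> \<gamma>)"
      by (rule continuous_on_compose[OF F(2)], rule continuous_on_subset[OF cont_f]) (use \<gamma>_ball in auto)
    moreover have "(f \<circ> \<gamma>) C1_differentiable_on ({0..1} - F)"
      unfolding C1_differentiable_on_def T_def[symmetric]
      by (intro exI[of _ "\<lambda>t. series_deriv \<alpha> (\<gamma> t) (?D t)"] conjI ballI der cont_D)
    ultimately show "valid_path (f \<circ> \<gamma>)"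
      using F(1) by (auto simp: valid_path_def piecewise_C1_differentiable_on_def)
    show "path_image (f \<circ> \<gamma>) \<subseteq> \<bool>" using \<gamma>_ball ball by (auto simp: path_image_def)
    show "?s' integrable_on {0..1}" using int_s' spike(1) by blast
  qed (use adm in \<open>simp_all add: admissible_curve_def pathstart_def pathfinish_def\<close>)
  then have "dist_g (f p) (f q) \<le> curve_length (f \<circ> \<gamma>)" by (rule dist_g_le_curve_length)
  also have "\<dots> \<le> curve_length \<gamma>"
    unfolding curve_length_def spike(2) by (rule integral_le[OF int_s' int_s le])
  finally show "dist_g (f p) (f q) \<le> curve_length \<gamma>" .
qed

theorem theorem5p4:
  fixes f :: "quat \<Rightarrow> quat"
  assumes "inner_function f"
  shows "((\<exists>K. \<forall>p\<in>\<bool>. \<forall>q\<in>\<bool>. dist_g (f p) (f q) \<le> K * dist_g p q) \<longleftrightarrow> slice_preserving f) \<and>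
    (slice_preserving f \<longrightarrow> (\<forall>p\<in>\<bool>. \<forall>q\<in>\<bool>. dist_g (f p) (f q) \<le> dist_g p q))"
proof -
  have contraction: "dist_g (f p) (f q) \<le> dist_g p q" if "slice_preserving f" "p \<in> \<bool>" "q \<in> \<bool>" for p q
    using assms slice_preserving_contraction[OF _ _ that] by (auto simp: inner_function_def)
  moreover have "\<exists>K. \<forall>p\<in>\<bool>. \<forall>q\<in>\<bool>. dist_g (f p) (f q) \<le> K * dist_g p q" if "slice_preserving f"
    using contraction[OF that] by (intro exI[of _ 1]) simp
  moreover have "slice_preserving f"
    if "\<exists>K. \<forall>p\<in>\<bool>. \<forall>q\<in>\<bool>. dist_g (f p) (f q) \<le> K * dist_g p q"
    using that lipschitz_inner_imp_slice_preserving[OF assms] by blast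
  ultimately show ?thesis by blast
qed

end
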